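(* Let $L$, $M$ and $\Omega$ be as described in the context. Let $\mathcal{M}\colon\Omega\cap\ker L\to\ker L$ be defined by $$\mathcal{M}(u):=\bigl(\eta_1(u_2),\dots,\eta_{n-1}(u_n),-J_nQ_nM_n|_{\Omega\cap\ker L}u\bigr),\quad u=(u_1,\dots,u_n)\in\Omega\cap\ker L.$$ Assume that the degree $\deg_B(\mathcal{M},\Omega\cap\ker L,0)$ is well-defined and suppose that the following conditions hold: ($h_1$) $\dim(\ker L_i)=d$ for all $i=1,\dots,n$; ($h_2$) $0_{X_i}\in\Omega_i\cap\ker L_i$ for all $i=2,\dots,n$; ($h_3$) $\{w\in\Omega_{i+1}\cap\ker L_{i+1} : \eta_i(w)=0_{X_i}\}=\{0_{X_{i+1}}\}$ for all $i=1,\dots,n-1$. Then $$\deg_B(\mathcal{M},\Omega\cap\ker L,0)=(-1)^{d(n+1)}\,\deg_B(\eta_n,\tilde\Omega_1,0)\cdot\prod_{i=1}^{n-1}\deg_B(\eta_i,\Omega_{i+1}\cap\ker L_{i+1},0).$$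
   Context: Setting. For $i=1,\dots,n$, $X_i,Z_i$ are real normed linear spaces and $L_i\colon\mathrm{dom}\,L_i\,(\subseteq X_i)\to Z_i$ is a linear Fredholm mapping of index zero, i.e. $\mathrm{Im}\,L_i$ is closed in $Z_i$ and $\dim\ker L_i=\mathrm{codim}\,\mathrm{Im}\,L_i<\infty$. Fix continuous linear projections $P_i\colon X_i\to\ker L_i$ and $Q_i\colon Z_i\to\mathrm{coker}\,L_i$ with $X_i=\ker L_i\oplus\ker P_i$ and $Z_i=\mathrm{Im}\,L_i\oplus\mathrm{Im}\,Q_i$, where $\mathrm{coker}\,L_i$ is identified with the complementary subspace $\mathrm{Im}\,Q_i$ of $\mathrm{Im}\,L_i=\ker Q_i$ in $Z_i$. Let $K_i\colon\mathrm{Im}\,L_i\to\mathrm{dom}\,L_i\cap\ker P_i$ be the right inverse of $L_i$, and $J_i\colon\mathrm{coker}\,L_i\to\ker L_i$ an orientation-preserving linear isomorphism. Put $X=\prod_iX_i$, $Z=\prod_iZ_i$, $\mathrm{dom}\,L=\prod_i\mathrm{dom}\,L_i$, and define $L,Q,K$ componentwise; $\ker L=\prod_i\ker L_i$. For $\Omega\subseteq X$, $\Omega_i\subseteq X_i$ is its image under the standard projection $X\to X_i$. An operator $N\colon\mathrm{dom}\,N\,(\subseteq X)\to Z$ is $L$-completely continuous if $N$ and $K(Id_Z-Q)N$ are continuous and $QN(B)$, $K(Id_Z-Q)N(B)$ are relatively compact for each bounded $B\subseteq\mathrm{dom}\,N$. Standing assumptions on $M$ and $\Omega$. $M\colon\mathrm{dom}\,M\,(\subseteq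 X)\to Z$ is $L$-completely continuous with components $M_i(u_{i+1})$ for $i=1,\dots,n-1$ and $M_n(u_1,\dots,u_n)$; $\Omega\subseteq\mathrm{dom}\,M$ is an open (possibly unbounded) subset of $X$; and: (i) $\mathrm{Im}\,L_i\cap M_i(\Omega_{i+1}\cap\ker L_{i+1})\subseteq\{0_{Z_i}\}$ for $i=1,\dots,n-1$; (ii) there is a compact $\mathcal{K}\subseteq\Omega$ containing, for every $\vartheta\in\,]0,1]$, all $u\in\Omega\cap\mathrm{dom}\,L$ with $L_iu_i=M_i(u_{i+1})$ ($i=1,\dots,n-1$) and $L_nu_n=\vartheta M_n(u)$; (iii) $\{u\in\Omega\cap\ker L: QMu=0\}$ is compact. Notation. For $i=1,\dots,n-1$, $\eta_i\colon\Omega_{i+1}\cap\ker L_{i+1}\to\ker L_i$, $\eta_i(w):=-J_iQ_iM_iw$. Moreover $\tilde\Omega_1:=\{w\in\ker L_1:(w,0,\dots,0)\in\Omega\}$ and $\eta_n\colon\tilde\Omega_1\to\ker L_n$, $\eta_n(w):=-J_nQ_nM_n(w,0,\dots,0)$. Convention: under ($h_1$), each $\ker L_i$ and each $\mathrm{coker}\,L_i$ is identified with $\mathbb{R}^d$, and $J_i=Id_{\mathbb{R}^d}$ for all $i$; the Brouwer degrees of $\eta_i$ and $\mathcal{M}$ are understood with respect to these identifications. $\deg_B$ is the Brouwer degree, extended to open, possibly unbounded sets $U$: it is well-defined when the zero set in $U$ is compact, and then equals the usual degree on any bounded open $V$ containing the zero set with $\overline V\subseteq U$. *)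

theory Defs
  imports "HOL-Homology.Homology"
begin

section \<open>Brouwer degree on open subsets of Euclidean space\<close>

text \<open>
  The library provides the degree \<^const>\<open>Brouwer_degree2\<close> of a self-map of the sphere
  \<^term>\<open>nsphere m\<close>. The degree over an open set is obtained from it through the one-point
  compactification of \<^term>\<open>Euclidean_space m\<close>, for which inverse stereographic projection
  from the north pole (the point at infinity) is the chart. The same chart is used in the
  source and in the target, so the choice of orientation does not matter.
\<close>

definition inv_stereo :: "nat \<Rightarrow> (nat \<Rightarrow> real) \<Rightarrow> (nat \<Rightarrow> real)" where
  "inv_stereo m x =
    (let s = (\<Sum>i<m. (x i)\<^sup>2) in
      (\<lambda>i. if i < m then 2 * x i / (s + 1) else if i = m then (s - 1) / (s + 1) else 0))"

text \<open>
  \<open>F\<close> is a continuous self-map of the sphere that coincides with \<open>f\<close> on a neighbourhood \<open>W\<close> of the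
  fibre \<open>{x \<in> U. f x = p}\<close> and takes the value \<open>p\<close> nowhere outside this fibre (in particular not at
  infinity). If \<open>U\<close> is open, \<open>f\<close> continuous and the fibre compact, then such an \<open>F\<close> exists by
  Tietze's theorem. Any two such maps are homotopic: they agree on \<open>W \<inter> W'\<close>, and off that set both
  take their values in the contractible space (sphere minus one point).
\<close>

definition sphere_extension ::
    "nat \<Rightarrow> ((nat \<Rightarrow> real) \<Rightarrow> (nat \<Rightarrow> real)) \<Rightarrow> (nat \<Rightarrow> real) set \<Rightarrow> (nat \<Rightarrow> real)
      \<Rightarrow> ((nat \<Rightarrow> real) \<Rightarrow> (nat \<Rightarrow> real)) \<Rightarrow> bool" where
  "sphere_extension m f U p F \<longleftrightarrow>
    continuous_map (nsphere m) (nsphere m) F \<and>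
    (\<exists>W. openin (Euclidean_space m) W \<and> {x \<in> U. f x = p} \<subseteq> W \<and> W \<subseteq> U \<and>
         (\<forall>x\<in>W. F (inv_stereo m x) = inv_stereo m (f x))) \<and>
    {y \<in> topspace (nsphere m). F y = inv_stereo m p} \<subseteq> inv_stereo m ` {x \<in> U. f x = p}"

definition brouwer_degree_defined ::
    "nat \<Rightarrow> ((nat \<Rightarrow> real) \<Rightarrow> (nat \<Rightarrow> real)) \<Rightarrow> (nat \<Rightarrow> real) set \<Rightarrow> (nat \<Rightarrow> real) \<Rightarrow> bool" where
  "brouwer_degree_defined m f U p \<longleftrightarrow>
    openin (Euclidean_space m) U \<and>
    continuous_map (subtopology (Euclidean_space m) U) (Euclidean_space m) f \<and>
    p \<in> topspace (Euclidean_space m) \<and>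
    compactin (Euclidean_space m) {x \<in> U. f x = p}"

definition brouwer_degree ::
    "nat \<Rightarrow> ((nat \<Rightarrow> real) \<Rightarrow> (nat \<Rightarrow> real)) \<Rightarrow> (nat \<Rightarrow> real) set \<Rightarrow> (nat \<Rightarrow> real) \<Rightarrow> int" where
  "brouwer_degree m f U p = (THE k. \<exists>F. sphere_extension m f U p F \<and> k = Brouwer_degree2 m F)"

text \<open>
  Degree of a map between two \<open>m\<close>-dimensional spaces that are identified with
  \<^term>\<open>Euclidean_space m\<close> by bijections \<open>\<phi>\<close> (source) and \<open>\<psi>\<close> (target).
\<close>

definition pull_map ::
    "nat \<Rightarrow> ((nat \<Rightarrow> real) \<Rightarrow> 'a) \<Rightarrow> ((nat \<Rightarrow> real) \<Rightarrow> 'b) \<Rightarrow> ('a \<Rightarrow> 'b)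
      \<Rightarrow> (nat \<Rightarrow> real) \<Rightarrow> (nat \<Rightarrow> real)" where
  "pull_map m \<phi> \<psi> f = inv_into (topspace (Euclidean_space m)) \<psi> \<circ> f \<circ> \<phi>"

definition pull_set :: "nat \<Rightarrow> ((nat \<Rightarrow> real) \<Rightarrow> 'a) \<Rightarrow> 'a set \<Rightarrow> (nat \<Rightarrow> real) set" where
  "pull_set m \<phi> U = {x \<in> topspace (Euclidean_space m). \<phi> x \<in> U}"

definition degB ::
    "nat \<Rightarrow> ((nat \<Rightarrow> real) \<Rightarrow> 'a) \<Rightarrow> ((nat \<Rightarrow> real) \<Rightarrow> 'b) \<Rightarrow> ('a \<Rightarrow> 'b) \<Rightarrow> 'a set \<Rightarrow> 'b \<Rightarrow> int" where
  "degB m \<phi> \<psi> f U p =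
    brouwer_degree m (pull_map m \<phi> \<psi> f) (pull_set m \<phi> U)
      (inv_into (topspace (Euclidean_space m)) \<psi> p)"

definition degB_defined ::
    "nat \<Rightarrow> ((nat \<Rightarrow> real) \<Rightarrow> 'a) \<Rightarrow> ((nat \<Rightarrow> real) \<Rightarrow> 'b) \<Rightarrow> ('a \<Rightarrow> 'b) \<Rightarrow> 'a set \<Rightarrow> 'b \<Rightarrow> bool" where
  "degB_defined m \<phi> \<psi> f U p \<longleftrightarrow>
    brouwer_degree_defined m (pull_map m \<phi> \<psi> f) (pull_set m \<phi> U)
      (inv_into (topspace (Euclidean_space m)) \<psi> p)"

definition is_basis :: "nat \<Rightarrow> (nat \<Rightarrow> 'a::real_vector) \<Rightarrow> 'a set \<Rightarrow> bool" where
  "is_basis d b V \<longleftrightarrow> inj_on b {..<d} \<and> independent (b ` {..<d}) \<and> span (b ` {..<d}) = V"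

definition chart :: "nat \<Rightarrow> (nat \<Rightarrow> 'a::real_vector) \<Rightarrow> (nat \<Rightarrow> real) \<Rightarrow> 'a" where
  "chart d b x = (\<Sum>j<d. x j *\<^sub>R b j)"

text \<open>
  Identification of \<open>\<real>\<^sup>n\<^sup>d\<close>, read as \<open>n\<close> consecutive blocks of length \<open>d\<close>, with a product of \<open>n\<close>
  spaces of dimension \<open>d\<close>. Products over the indices \<open>1, \<dots>, n\<close> are extensional function spaces
  throughout.
\<close>

definition product_chart ::
    "nat \<Rightarrow> nat \<Rightarrow> (nat \<Rightarrow> nat \<Rightarrow> 'a::real_vector) \<Rightarrow> (nat \<Rightarrow> real) \<Rightarrow> (nat \<Rightarrow> 'a)" where
  "product_chart n d b x = (\<lambda>i\<in>{1..n}. chart d (b i) (\<lambda>j. x ((i - 1) * d + j)))"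


section \<open>Linear Fredholm mappings of index zero\<close>

text \<open>
  A normed linear space is modelled as a linear subspace of a type of class
  \<^class>\<open>real_normed_vector\<close>. Any finite family of normed spaces embeds isometrically into
  their max-normed product, so a family of subspaces of one type is fully general.
\<close>

definition linear_map_on ::
    "'a::real_vector set \<Rightarrow> 'b::real_vector set \<Rightarrow> ('a \<Rightarrow> 'b) \<Rightarrow> bool" where
  "linear_map_on S T f \<longleftrightarrow>
    subspace S \<and> subspace T \<and> f ` S \<subseteq> T \<and>
    (\<forall>x\<in>S. \<forall>y\<in>S. f (x + y) = f x + f y) \<and> (\<forall>c. \<forall>x\<in>S. f (c *\<^sub>R x) = c *\<^sub>R f x)"

definition ker_on :: "'a set \<Rightarrow> ('a \<Rightarrow> 'b::zero) \<Rightarrow> 'a set" where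
  "ker_on S f = {x \<in> S. f x = 0}"

definition finite_dimensional :: "'a::real_vector set \<Rightarrow> bool" where
  "finite_dimensional V \<longleftrightarrow> (\<exists>B. finite B \<and> V \<subseteq> span B)"

definition has_codim :: "'a::real_vector set \<Rightarrow> 'a set \<Rightarrow> nat \<Rightarrow> bool" where
  "has_codim V S k \<longleftrightarrow>
    (\<exists>C. finite C \<and> independent C \<and> card C = k \<and> C \<subseteq> V \<and>
         span C \<inter> S = {0} \<and> V = {c + s |c s. c \<in> span C \<and> s \<in> S})"

definition fredholm_index_zero ::
    "'a::real_normed_vector set \<Rightarrow> 'a set \<Rightarrow> 'b::real_normed_vector set \<Rightarrow> ('a \<Rightarrow> 'b) \<Rightarrow> bool" where
  "fredholm_index_zero X D Z L \<longleftrightarrow>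
    subspace X \<and> D \<subseteq> X \<and> linear_map_on D Z L \<and>
    closedin (top_of_set Z) (L ` D) \<and>
    finite_dimensional (ker_on D L) \<and> has_codim Z (L ` D) (dim (ker_on D L))"

definition continuous_projection :: "'a::real_normed_vector set \<Rightarrow> ('a \<Rightarrow> 'a) \<Rightarrow> bool" where
  "continuous_projection V R \<longleftrightarrow>
    linear_map_on V V R \<and> continuous_on V R \<and> (\<forall>x\<in>V. R (R x) = R x)"

text \<open>
  The cokernel of \<open>L i\<close> is the complement \<open>Q i ` Z i\<close> of the image of \<open>L i\<close>. The decompositions
  \<open>X i = ker (L i) \<oplus> ker (P i)\<close> and \<open>Z i = Im (L i) \<oplus> Im (Q i)\<close> are the usual ones for idempotents
  with the stated image or kernel.
\<close>

locale fredholm_system =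
  fixes n :: nat
    and X :: "nat \<Rightarrow> 'x::real_normed_vector set"
    and Z :: "nat \<Rightarrow> 'z::real_normed_vector set"
    and domL :: "nat \<Rightarrow> 'x set"
    and L :: "nat \<Rightarrow> 'x \<Rightarrow> 'z"
    and P :: "nat \<Rightarrow> 'x \<Rightarrow> 'x"
    and Q :: "nat \<Rightarrow> 'z \<Rightarrow> 'z"
    and K :: "nat \<Rightarrow> 'z \<Rightarrow> 'x"
    and J :: "nat \<Rightarrow> 'z \<Rightarrow> 'x"
  assumes n_pos: "1 \<le> n"
    and fredholm: "i \<in> {1..n} \<Longrightarrow> fredholm_index_zero (X i) (domL i) (Z i) (L i)"
    and P_proj: "i \<in> {1..n} \<Longrightarrow> continuous_projection (X i) (P i)"
    and P_image: "i \<in> {1..n} \<Longrightarrow> P i ` X i = ker_on (domL i) (L i)"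
    and Q_proj: "i \<in> {1..n} \<Longrightarrow> continuous_projection (Z i) (Q i)"
    and Q_kernel: "i \<in> {1..n} \<Longrightarrow> ker_on (Z i) (Q i) = L i ` domL i"
    and K_right_inverse:
      "i \<in> {1..n} \<Longrightarrow> z \<in> L i ` domL i \<Longrightarrow>
         K i z \<in> domL i \<inter> ker_on (X i) (P i) \<and> L i (K i z) = z"
    and J_linear:
      "i \<in> {1..n} \<Longrightarrow> linear_map_on (Q i ` Z i) (ker_on (domL i) (L i)) (J i)"
    and J_bij:
      "i \<in> {1..n} \<Longrightarrow> bij_betw (J i) (Q i ` Z i) (ker_on (domL i) (L i))"


section \<open>The nonlinear operator\<close>

definition product_space :: "nat \<Rightarrow> (nat \<Rightarrow> 'a::topological_space set) \<Rightarrow> (nat \<Rightarrow> 'a) topology" where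
  "product_space n X = product_topology (\<lambda>i. top_of_set (X i)) {1..n}"

definition relatively_compact_in :: "'a topology \<Rightarrow> 'a set \<Rightarrow> bool" where
  "relatively_compact_in T S \<longleftrightarrow> S \<subseteq> topspace T \<and> compactin T (T closure_of S)"

definition product_bounded :: "nat \<Rightarrow> (nat \<Rightarrow> 'a::metric_space) set \<Rightarrow> bool" where
  "product_bounded n B \<longleftrightarrow> (\<forall>i\<in>{1..n}. bounded ((\<lambda>u. u i) ` B))"

definition cyclic_operator ::
    "nat \<Rightarrow> (nat \<Rightarrow> 'x \<Rightarrow> 'z) \<Rightarrow> ((nat \<Rightarrow> 'x) \<Rightarrow> 'z) \<Rightarrow> (nat \<Rightarrow> 'x) \<Rightarrow> (nat \<Rightarrow> 'z)" where
  "cyclic_operator n M Mn u = (\<lambda>i\<in>{1..n}. if i < n then M i (u (i + 1)) else Mn u)"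

definition L_completely_continuous ::
    "nat \<Rightarrow> (nat \<Rightarrow> 'x::real_normed_vector set) \<Rightarrow> (nat \<Rightarrow> 'z::real_normed_vector set)
      \<Rightarrow> (nat \<Rightarrow> 'z \<Rightarrow> 'z) \<Rightarrow> (nat \<Rightarrow> 'z \<Rightarrow> 'x)
      \<Rightarrow> (nat \<Rightarrow> 'x) set \<Rightarrow> ((nat \<Rightarrow> 'x) \<Rightarrow> (nat \<Rightarrow> 'z)) \<Rightarrow> bool" where
  "L_completely_continuous n X Z Q K domN N \<longleftrightarrow>
    (let QN = (\<lambda>u. \<lambda>i\<in>{1..n}. Q i (N u i));
         KN = (\<lambda>u. \<lambda>i\<in>{1..n}. K i (N u i - Q i (N u i)))
     in continuous_map (subtopology (product_space n X) domN) (product_space n Z) N \<and>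
        continuous_map (subtopology (product_space n X) domN) (product_space n X) KN \<and>
        (\<forall>B\<subseteq>domN. product_bounded n B \<longrightarrow>
           relatively_compact_in (product_space n Z) (QN ` B) \<and>
           relatively_compact_in (product_space n X) (KN ` B)))"

text \<open>
  \<open>M i\<close> for \<open>i \<in> {1..<n}\<close> are the components depending on the next variable only; \<open>Mn\<close> is the last
  component. The component \<open>\<Omega>\<^sub>i\<close> of \<open>\<Omega>\<close> is \<open>(\<lambda>u. u i) ` \<Omega>\<close>.
\<close>

locale cyclic_coincidence = fredholm_system n X Z domL L P Q K J
  for n :: nat
    and X :: "nat \<Rightarrow> 'x::real_normed_vector set"
    and Z :: "nat \<Rightarrow> 'z::real_normed_vector set"
    and domL L P Q K J +
  fixes domM :: "(nat \<Rightarrow> 'x) set"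
    and M :: "nat \<Rightarrow> 'x \<Rightarrow> 'z"
    and Mn :: "(nat \<Rightarrow> 'x) \<Rightarrow> 'z"
    and \<Omega> :: "(nat \<Rightarrow> 'x) set"
  assumes domM: "domM \<subseteq> (\<Pi>\<^sub>E i\<in>{1..n}. X i)"
    and M_range: "cyclic_operator n M Mn ` domM \<subseteq> (\<Pi>\<^sub>E i\<in>{1..n}. Z i)"
    and M_compact: "L_completely_continuous n X Z Q K domM (cyclic_operator n M Mn)"
    and Omega_sub: "\<Omega> \<subseteq> domM"
    and Omega_open: "openin (product_space n X) \<Omega>"
    and cond_i:
      "i \<in> {1..<n} \<Longrightarrow>
         (L i ` domL i) \<inter> M i ` ((\<lambda>u. u (i + 1)) ` \<Omega> \<inter> ker_on (domL (i + 1)) (L (i + 1))) \<subseteq> {0}"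
    and cond_ii:
      "\<exists>C. compactin (product_space n X) C \<and> C \<subseteq> \<Omega> \<and>
         (\<forall>\<theta>::real. 0 < \<theta> \<and> \<theta> \<le> 1 \<longrightarrow>
           {u \<in> \<Omega> \<inter> (\<Pi>\<^sub>E i\<in>{1..n}. domL i).
              (\<forall>i\<in>{1..<n}. L i (u i) = M i (u (i + 1))) \<and> L n (u n) = \<theta> *\<^sub>R Mn u} \<subseteq> C)"
    and cond_iii:
      "compactin (product_space n X)
         {u \<in> \<Omega> \<inter> (\<Pi>\<^sub>E i\<in>{1..n}. ker_on (domL i) (L i)).
            \<forall>i\<in>{1..n}. Q i (cyclic_operator n M Mn u i) = 0}"

definition eta ::
    "(nat \<Rightarrow> 'z \<Rightarrow> 'x::real_vector) \<Rightarrow> (nat \<Rightarrow> 'z \<Rightarrow> 'z) \<Rightarrow> (nat \<Rightarrow> 'x \<Rightarrow> 'z) \<Rightarrow> nat \<Rightarrow> 'x \<Rightarrow> 'x" where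
  "eta J Q M i w = - J i (Q i (M i w))"

definition first_axis :: "nat \<Rightarrow> 'x::zero \<Rightarrow> nat \<Rightarrow> 'x" where
  "first_axis n w = (\<lambda>i\<in>{1..n}. if i = 1 then w else 0)"

definition eta_last ::
    "nat \<Rightarrow> (nat \<Rightarrow> 'z \<Rightarrow> 'x::real_vector) \<Rightarrow> (nat \<Rightarrow> 'z \<Rightarrow> 'z) \<Rightarrow> ((nat \<Rightarrow> 'x) \<Rightarrow> 'z) \<Rightarrow> 'x \<Rightarrow> 'x" where
  "eta_last n J Q Mn w = - J n (Q n (Mn (first_axis n w)))"

definition finite_map ::
    "nat \<Rightarrow> (nat \<Rightarrow> 'z \<Rightarrow> 'x::real_vector) \<Rightarrow> (nat \<Rightarrow> 'z \<Rightarrow> 'z) \<Rightarrow> (nat \<Rightarrow> 'x \<Rightarrow> 'z)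
      \<Rightarrow> ((nat \<Rightarrow> 'x) \<Rightarrow> 'z) \<Rightarrow> (nat \<Rightarrow> 'x) \<Rightarrow> (nat \<Rightarrow> 'x)" where
  "finite_map n J Q M Mn u =
    (\<lambda>i\<in>{1..n}. if i < n then eta J Q M i (u (i + 1)) else - J n (Q n (Mn u)))"

end

theory Submission
  imports Defs "HOL-Combinatorics.Permutations"
begin

text \<open>
  A zero of the finite-dimensional map has vanishing components \<open>u\<^sub>2, \<dots>, u\<^sub>n\<close>, so its zero set lies on
  the first axis. Hence near the zeros \<open>\<M>\<close> is homotopic, with a constant zero set, to the
  decoupled map \<open>(\<eta>\<^sub>1(u\<^sub>2), \<dots>, \<eta>\<^sub>n\<^sub>-\<^sub>1(u\<^sub>n), \<eta>\<^sub>n(u\<^sub>1))\<close>, which is a cyclic rotation of the \<open>n\<close> blocks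
  after a product map. The rotation has sign \<open>(-1)\<close> to the power \<open>d (n d - 1)\<close>, of the parity of
  \<open>d (n + 1)\<close>. A product map is a composition of maps acting on one block, and such a map is an
  iterated suspension of its block map up to a permutation of coordinates, so it has the same degree.

  To compute on spheres, a map with compact zero set is divided by a cutoff function. The quotient
  is a proper map on an open set and extends by the value \<open>\<infinity>\<close> to the one-point compactification.
\<close>

text \<open>The degree is a definite description over all sphere extensions, so each evaluation
  needs one explicit extension and the fact that its degree depends only on the behaviour near the
  fibre. Lifts of proper partial maps are convenient extensions because they compose: the composite
  of two lifts is the lift of the composite on its natural domain, infinity absorbing whatever
  leaves a domain. Multiplicativity on spheres then takes the place of a product formula in
  homology. The obstacle is that continuity is at hand for the joint map on
  \<open>\<Omega> \<inter> ker L\<close>, while \<open>\<eta>\<^sub>i\<close> lives on a projection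
  of \<open>\<Omega>\<close>. Only a neighbourhood of its zero matters, and there
  \<open>\<eta>\<^sub>i\<close> is read off from the joint map on a slice through a zero of that
  map. Such a zero has to exist, so the case without zeros, where both sides are 0, is settled
  separately.\<close>

abbreviation (input) "EE m \<equiv> topspace (Euclidean_space m)"
abbreviation (input) "SS m \<equiv> topspace (nsphere m)"


section \<open>Suspension of maps of spheres\<close>

text \<open>Three isomorphisms link the reduced homology of the equator to that of the sphere one
  degree up: the boundary map of the pair (upper hemisphere, equator), excision into the pair
  (sphere, lower hemisphere), and the map into that pair from the sphere, whose lower hemisphere is
  contractible. A map that respects both hemispheres acts on all these pairs and commutes with all
  three.\<close>

lemma Brouwer_degree2_equator:
  assumes cmf: "continuous_map (nsphere (Suc n)) (nsphere (Suc n)) f"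
    and up: "\<And>x. x \<in> SS (Suc n) \<Longrightarrow> 0 \<le> x (Suc n) \<Longrightarrow> 0 \<le> f x (Suc n)"
    and lo: "\<And>x. x \<in> SS (Suc n) \<Longrightarrow> x (Suc n) \<le> 0 \<Longrightarrow> f x (Suc n) \<le> 0"
  shows "Brouwer_degree2 (Suc n) f = Brouwer_degree2 n f"
proof -
  \<comment> \<open>Naturality of the induced homomorphisms needs inclusions of whole sets, not only of their
    intersections with the sphere; hence the change of \<open>f\<close> off the sphere.\<close>
  define r where "r \<equiv> \<lambda>x. if x \<in> SS (Suc n) then f x else (\<lambda>i. 0)"
  have cmr: "continuous_map (nsphere (Suc n)) (nsphere (Suc n)) r"
    by (rule continuous_map_eq [OF cmf]) (auto simp: r_def)
  have sub: "SS n \<subseteq> SS (Suc n)"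
    by (metis subtopology_nsphere_equator topspace_subtopology inf_le1)
  have deg_r: "Brouwer_degree2 (Suc n) f = Brouwer_degree2 (Suc n) r"
    "Brouwer_degree2 n f = Brouwer_degree2 n r"
    using sub by (auto intro!: Brouwer_degree2_eq simp: r_def)
  have rsub: "r \<in> {x. 0 \<le> x (Suc n)} \<rightarrow> {x. 0 \<le> x (Suc n)}"
    "r \<in> {x. x (Suc n) \<le> 0} \<rightarrow> {x. x (Suc n) \<le> 0}"
    using up lo by (auto simp: r_def)
  then have rsub0: "r \<in> {x. x (Suc n) = 0} \<rightarrow> {x. x (Suc n) = 0}"
    by (force simp: Pi_iff intro: order_antisym)
  have cmr': "continuous_map (nsphere n) (nsphere n) r"
    using cmr rsub0 by (metis (no_types, lifting) IntE Pi_iff continuous_map_from_subtopology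
        continuous_map_into_subtopology subtopology_nsphere_equator topspace_subtopology)
  define p where "p = int n"
  let ?S = "nsphere (Suc n)"
  let ?U = "subtopology ?S {x. 0 \<le> x (Suc n)}"
  let ?E = "{x. x (Suc n) = (0::real)}"
  let ?L = "{x. x (Suc n) \<le> (0::real)}"
  let ?G0 = "reduced_homology_group p (nsphere n)"
  let ?G1 = "relative_homology_group (1 + p) ?U ?E"
  let ?G2 = "relative_homology_group (1 + p) ?S ?L"
  let ?G3 = "reduced_homology_group (1 + p) ?S"
  let ?r0 = "hom_induced p (nsphere n) {} (nsphere n) {} r"
  let ?r1 = "hom_induced (1 + p) ?U ?E ?U ?E r"
  let ?r2 = "hom_induced (1 + p) ?S ?L ?S ?L r"
  let ?r3 = "hom_induced (1 + p) ?S {} ?S {} r"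
  have cmU: "continuous_map ?U ?U r"
    using cmr rsub(1) by (metis (no_types, lifting) IntE Pi_iff continuous_map_from_subtopology
        continuous_map_into_subtopology topspace_subtopology)
  \<comment> \<open>The boundary map runs from \<open>?G1\<close> to \<open>?G0\<close>;
    \<open>isomorphism_sym\<close> reverses its naturality square.\<close>
  have "\<exists>f\<in>iso ?G0 ?G1. \<forall>c\<in>carrier ?G0. ?r1 (f c) = f (?r0 c)"
  proof (rule isomorphism_sym)
    show "hom_boundary (1 + p) ?U ?E \<in> iso ?G1 ?G0"
      using iso_upper_hemisphere_reduced_homology_group by blast
    have "?r0 \<circ> hom_boundary (1 + p) ?U ?E = hom_boundary (1 + p) ?U ?E \<circ> ?r1"
      using naturality_hom_induced [OF cmU rsub0, symmetric, of "1 + p"]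
      by (simp add: subtopology_subtopology subtopology_nsphere_equator flip: Collect_conj_eq
          cong: rev_conj_cong)
    then show "?r0 (hom_boundary (1 + p) ?U ?E c) = hom_boundary (1 + p) ?U ?E (?r1 c)" for c
      by (metis comp_def)
  qed (auto simp: hom_induced_carrier)
  moreover have "\<exists>f\<in>iso ?G1 ?G2. \<forall>c\<in>carrier ?G1. ?r2 (f c) = f (?r1 c)"
  proof (intro bexI ballI)
    fix c
    have "?r2 \<circ> hom_induced (1 + p) ?U ?E ?S ?L id = hom_induced (1 + p) ?U ?E ?S ?L id \<circ> ?r1"
      using rsub rsub0 cmU cmr
      by (subst (1 2) hom_induced_compose [symmetric])
        (auto simp: continuous_map_from_subtopology)
    then show "?r2 (hom_induced (1 + p) ?U ?E ?S ?L id c) = hom_induced (1 + p) ?U ?E ?S ?L id (?r1 c)"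
      by (metis comp_def)
  qed (rule iso_relative_homology_group_upper_hemisphere)
  moreover have "\<exists>f\<in>iso ?G2 ?G3. \<forall>c\<in>carrier ?G2. ?r3 (f c) = f (?r2 c)"
  proof (rule isomorphism_sym)
    show "hom_induced (1 + p) ?S {} ?S ?L id \<in> iso ?G3 ?G2"
      using iso_reduced_homology_group_lower_hemisphere by blast
    show "?r2 (hom_induced (1 + p) ?S {} ?S ?L id c) = hom_induced (1 + p) ?S {} ?S ?L id (?r3 c)" for c
      by (simp add: hom_induced_compose' cmr rsub)
  qed (auto simp: hom_induced_reduced)
  ultimately have "\<exists>f\<in>iso ?G0 ?G3. \<forall>c\<in>carrier ?G0. ?r3 (f c) = f (?r0 c)"
    by (rule isomorphism_trans [OF isomorphism_trans])
  then obtain h where h: "h \<in> iso ?G0 ?G3" and eq: "\<And>c. c \<in> carrier ?G0 \<Longrightarrow> ?r3 (h c) = h (?r0 c)"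
    by blast
  interpret group_hom ?G0 ?G3 h
    using h by (simp add: group_hom_def group_hom_axioms_def iso_def)
  \<comment> \<open>Since \<open>h\<close> intertwines the two actions, the one on
    \<open>?G3\<close> is multiplication by the same integer as the one on
    \<open>?G0\<close>.\<close>
  have "Brouwer_degree2 (Suc n) r = Brouwer_degree2 n r"
  proof (rule Brouwer_degree2_unique [OF cmr])
    fix x assume "x \<in> carrier (reduced_homology_group (int (Suc n)) (nsphere (Suc n)))"
    then have x: "x \<in> carrier ?G3" by (simp add: p_def)
    then obtain y where y: "y \<in> carrier ?G0" "x = h y"
      using h by (auto simp: iso_iff)
    have "?r3 x = h (y [^]\<^bsub>?G0\<^esub> Brouwer_degree2 n r)"
      using eq [OF y(1)] y Brouwer_degree2 [of y n r] by (simp add: p_def)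
    then show "hom_induced (int (Suc n)) (nsphere (Suc n)) {} (nsphere (Suc n)) {} r x
        = x [^]\<^bsub>reduced_homology_group (int (Suc n)) (nsphere (Suc n))\<^esub> Brouwer_degree2 n r"
      using y hom_int_pow by (simp add: p_def)
  qed
  then show ?thesis
    by (simp add: deg_r)
qed

section \<open>Stereographic projection\<close>

lemma Euclidean_space_eq: "Euclidean_space m = top_of_set (EE m)"
  by (simp add: Euclidean_space_def euclidean_product_topology)

lemma nsphere_eq: "nsphere m = top_of_set (SS m)"
  by (simp add: nsphere euclidean_product_topology)

lemma in_topspace_Euclidean_space: "x \<in> EE m \<longleftrightarrow> (\<forall>i\<ge>m. x i = 0)"
  by (simp add: topspace_Euclidean_space)

lemma topspace_nsphere_iff:
  "x \<in> SS m \<longleftrightarrow> (\<Sum>i\<le>m. (x i)\<^sup>2) = 1 \<and> (\<forall>i>m. x i = 0)"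
  by (simp add: nsphere)

lemma continuous_map_nsphere_iff:
  "continuous_map (nsphere m) (nsphere n) f \<longleftrightarrow>
    continuous_on (SS m) f \<and> f \<in> SS m \<rightarrow> SS n"
proof -
  have "continuous_map (nsphere m) (nsphere n) f \<longleftrightarrow>
    continuous_map (top_of_set (SS m)) (top_of_set (SS n)) f"
    using nsphere_eq by metis
  then show ?thesis
    by (auto simp: continuous_map_in_subtopology)
qed

lemma continuous_on_coordinate [continuous_intros]: "continuous_on S (\<lambda>x. x i)"
  by (rule continuous_on_product_then_coordinatewise) (rule continuous_on_id)

definition north_pole :: "nat \<Rightarrow> nat \<Rightarrow> real" where
  "north_pole m = (\<lambda>i. if i = m then 1 else 0)"

definition stereo :: "nat \<Rightarrow> (nat \<Rightarrow> real) \<Rightarrow> (nat \<Rightarrow> real)" where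
  "stereo m y = (\<lambda>i. if i < m then y i / (1 - y m) else 0)"

definition norm_sq :: "nat \<Rightarrow> (nat \<Rightarrow> real) \<Rightarrow> real" where
  "norm_sq m x = (\<Sum>i<m. (x i)\<^sup>2)"

lemma norm_sq_nonneg [simp]: "0 \<le> norm_sq m x"
  by (simp add: norm_sq_def sum_nonneg)

lemma norm_sq_pos [simp]: "0 < norm_sq m x + 1" "norm_sq m x + 1 \<noteq> 0" "1 + norm_sq m x \<noteq> 0"
  using norm_sq_nonneg [of m x] by linarith+

lemma norm_sq_eq_0: "x \<in> EE m \<Longrightarrow> norm_sq m x = 0 \<longleftrightarrow> x = (\<lambda>i. 0)"
  by (auto simp: norm_sq_def sum_nonneg_eq_0_iff in_topspace_Euclidean_space fun_eq_iff)
    (metis lessThan_iff not_less)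

lemma continuous_on_norm_sq [continuous_intros]:
  "continuous_on S f \<Longrightarrow> continuous_on S (\<lambda>x. norm_sq m (f x))"
  unfolding norm_sq_def
  by (intro continuous_on_sum continuous_on_power) (rule continuous_on_product_then_coordinatewise)

lemma inv_stereo_alt:
  "inv_stereo m x = (\<lambda>i. if i < m then 2 * x i / (norm_sq m x + 1)
     else if i = m then (norm_sq m x - 1) / (norm_sq m x + 1) else 0)"
  unfolding inv_stereo_def norm_sq_def Let_def by (rule refl)

lemma inv_stereo_in_nsphere: "inv_stereo m x \<in> SS m"
proof -
  let ?s = "norm_sq m x"
  have "(\<Sum>i\<le>m. (inv_stereo m x i)\<^sup>2)
      = (\<Sum>i<m. (2 * x i / (?s + 1))\<^sup>2) + ((?s - 1) / (?s + 1))\<^sup>2"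
    by (simp add: inv_stereo_alt flip: lessThan_Suc_atMost)
  also have "(\<Sum>i<m. (2 * x i / (?s + 1))\<^sup>2) = 4 * ?s / (?s + 1)\<^sup>2"
    by (simp add: norm_sq_def power_divide power_mult_distrib sum_distrib_left flip: sum_divide_distrib)
  also have "4 * ?s / (?s + 1)\<^sup>2 + ((?s - 1) / (?s + 1))\<^sup>2 = (4 * ?s + (?s - 1)\<^sup>2) / (?s + 1)\<^sup>2"
    by (simp add: power_divide add_divide_distrib)
  also have "4 * ?s + (?s - 1)\<^sup>2 = (?s + 1)\<^sup>2"
    by (simp add: power2_eq_square algebra_simps)
  finally show ?thesis
    by (simp add: topspace_nsphere_iff) (simp add: inv_stereo_alt)
qed

lemma inv_stereo_neq_north_pole [simp]: "inv_stereo m x \<noteq> north_pole m"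
proof
  assume "inv_stereo m x = north_pole m"
  then have "(norm_sq m x - 1) / (norm_sq m x + 1) = 1"
    by (auto simp: inv_stereo_alt north_pole_def fun_eq_iff dest: spec [of _ m])
  then show False by (simp add: field_simps)
qed

lemma stereo_in_Euclidean_space [simp]: "stereo m y \<in> EE m"
  by (simp add: stereo_def in_topspace_Euclidean_space)

lemma stereo_inv_stereo [simp]:
  assumes "x \<in> EE m"
  shows "stereo m (inv_stereo m x) = x"
proof -
  let ?s = "norm_sq m x"
  have "1 - inv_stereo m x m = 2 / (?s + 1)"
    by (simp add: inv_stereo_alt field_simps)
  then show ?thesis
    using assms by (auto simp: stereo_def inv_stereo_alt in_topspace_Euclidean_space fun_eq_iff)
qed

lemma north_pole_in_nsphere [simp]: "north_pole m \<in> SS m"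
  by (simp add: topspace_nsphere_iff north_pole_def if_distrib [of "\<lambda>x. x ^ 2"] cong: if_cong)

lemma nsphere_coordinate_le_1: "y \<in> SS m \<Longrightarrow> y i \<le> 1"
  using topspace_nsphere_1 [of y m i] power2_le_imp_le [of "y i" 1] by fastforce

lemma north_pole_iff: "y \<in> SS m \<Longrightarrow> y = north_pole m \<longleftrightarrow> y m = 1"
  using topspace_nsphere_1_eq_0 [of y m m] by (auto simp: north_pole_def fun_eq_iff)

lemma inv_stereo_stereo [simp]:
  assumes y: "y \<in> SS m" "y \<noteq> north_pole m"
  shows "inv_stereo m (stereo m y) = y"
proof -
  have lt: "y m < 1"
    using nsphere_coordinate_le_1 [OF y(1), of m] north_pole_iff [OF y(1)] y(2) by fastforce
  have "(\<Sum>i<m. (y i)\<^sup>2) = 1 - (y m)\<^sup>2"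
    using y(1) by (simp add: topspace_nsphere_iff flip: lessThan_Suc_atMost)
  then have "norm_sq m (stereo m y) = (1 - (y m)\<^sup>2) / (1 - y m)\<^sup>2"
    by (simp add: norm_sq_def stereo_def power_divide flip: sum_divide_distrib)
  also have "\<dots> = (1 + y m) / (1 - y m)"
    using lt by (simp add: divide_simps) (simp add: power2_eq_square algebra_simps)
  finally have s: "norm_sq m (stereo m y) = (1 + y m) / (1 - y m)" .
  then have "norm_sq m (stereo m y) + 1 = 2 / (1 - y m)"
    using lt by (simp add: field_simps)
  moreover have "norm_sq m (stereo m y) - 1 = 2 * y m / (1 - y m)"
    using lt s by (simp add: field_simps)
  ultimately show ?thesis
    using y(1) lt by (auto simp: inv_stereo_alt fun_eq_iff stereo_def topspace_nsphere_iff)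
qed

lemma continuous_on_inv_stereo [continuous_intros]:
  "continuous_on S f \<Longrightarrow> continuous_on S (\<lambda>x. inv_stereo m (f x))"
proof (rule continuous_on_coordinatewise_then_product)
  fix i assume f: "continuous_on S f"
  show "continuous_on S (\<lambda>x. inv_stereo m (f x) i)"
    unfolding inv_stereo_alt by (cases "i < m"; cases "i = m") (auto intro!: continuous_intros f
        continuous_on_product_then_coordinatewise [OF f])
qed

lemma continuous_on_stereo: "continuous_on (SS m - {north_pole m}) (stereo m)"
proof (rule continuous_on_coordinatewise_then_product)
  fix i
  show "continuous_on (SS m - {north_pole m}) (\<lambda>x. stereo m x i)"
    unfolding stereo_def
    by (cases "i < m") (auto intro!: continuous_intros simp: north_pole_iff)
qed

lemma inv_stereo_inj:
  "x \<in> EE m \<Longrightarrow> y \<in> EE m \<Longrightarrow>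
    inv_stereo m x = inv_stereo m y \<longleftrightarrow> x = y"
  by (metis stereo_inv_stereo)

text \<open>Tychonoff's theorem for the product topology on a function type. Compactness of spheres
  and balls follows by cutting this box with closed sets.\<close>

lemma compact_coordinate_box: "compact {x::'a \<Rightarrow> real. \<forall>i. \<bar>x i\<bar> \<le> B}"
proof -
  have "compactin (product_topology (\<lambda>i::'a. euclideanreal) UNIV) (PiE UNIV (\<lambda>i. {-B..B}))"
    by (simp add: compactin_PiE)
  moreover have "PiE UNIV (\<lambda>i::'a. {-B..B}) = {x. \<forall>i. \<bar>x i\<bar> \<le> B}"
    by (auto simp: PiE_iff abs_le_iff) (metis neg_le_iff_le minus_minus)+
  ultimately show ?thesis
    by (simp add: euclidean_product_topology)
qed

lemma closed_Euclidean_space: "closed (EE m)"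
  by (metis closedin_Euclidean_space_iff closedin_topspace)

lemma compact_nsphere: "compact (SS m)"
proof -
  have "x \<in> SS m \<longleftrightarrow>
      (\<forall>i. \<bar>x i\<bar> \<le> 1) \<and> norm_sq (Suc m) x = 1 \<and> x \<in> EE (Suc m)" for x
  proof -
    have "\<bar>x i\<bar> \<le> 1" if "x \<in> SS m" for i
      using topspace_nsphere_1 [OF that, of i] by (simp only: abs_square_le_1)
    moreover have "x \<in> SS m \<longleftrightarrow>
        norm_sq (Suc m) x = 1 \<and> x \<in> EE (Suc m)"
      by (simp add: topspace_nsphere_iff in_topspace_Euclidean_space norm_sq_def lessThan_Suc_atMost
          Suc_le_eq)
    ultimately show ?thesis by blast
  qed
  then have "SS m = {x. \<forall>i. \<bar>x i\<bar> \<le> 1} \<inter>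
      ({x. norm_sq (Suc m) x = 1} \<inter> EE (Suc m))"
    by blast
  moreover have "closed {x. norm_sq (Suc m) x = 1}"
    by (intro closed_Collect_eq continuous_intros)
  ultimately show ?thesis
    by (simp add: compact_Int_closed closed_Int compact_coordinate_box closed_Euclidean_space)
qed

lemma compact_norm_sq_le: "compact {x \<in> EE m. norm_sq m x \<le> R}"
proof -
  \<comment> \<open>The number \<open>\<bar>R\<bar> + 1\<close> is at least 1, so its square
    dominates it; it bounds the coordinates for every real \<open>R\<close>.\<close>
  have "\<bar>x i\<bar> \<le> \<bar>R\<bar> + 1" if "x \<in> EE m" "norm_sq m x \<le> R" for x i
  proof (cases "i < m")
    case True
    then have "(x i)\<^sup>2 \<le> norm_sq m x"
      unfolding norm_sq_def by (intro member_le_sum) auto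
    moreover have "\<bar>R\<bar> + 1 \<le> (\<bar>R\<bar> + 1)\<^sup>2"
      by (rule self_le_power) auto
    ultimately have "\<bar>x i\<bar>\<^sup>2 \<le> (\<bar>R\<bar> + 1)\<^sup>2"
      using that by simp
    then show ?thesis by (rule power2_le_imp_le) simp
  qed (use that in \<open>auto simp: in_topspace_Euclidean_space\<close>)
  then have "{x \<in> EE m. norm_sq m x \<le> R}
    = {x. \<forall>i. \<bar>x i\<bar> \<le> \<bar>R\<bar> + 1} \<inter> ({x. norm_sq m x \<le> R} \<inter> EE m)"
    by auto
  moreover have "closed {x. norm_sq m x \<le> R}"
    by (intro closed_Collect_le continuous_intros)
  ultimately show ?thesis
    by (simp add: compact_Int_closed closed_Int compact_coordinate_box closed_Euclidean_space)
qed

section \<open>One-point compactification of proper partial maps\<close>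

lemma openin_Euclidean_space_iff: "openin (Euclidean_space m) D \<longleftrightarrow> openin (top_of_set (EE m)) D"
  using Euclidean_space_eq [of m] by simp

lemma continuous_on_open_preimageI:
  assumes "\<And>B::'b::topological_space set. open B \<Longrightarrow> openin (top_of_set S) {x \<in> S. f x \<in> B}"
  shows "continuous_on S f"
  using assms unfolding continuous_openin_preimage_eq by (simp add: Int_def)

text \<open>On the compact set \<open>SS m \<inter> B\<close> the height attains a maximum
  \<open>z m\<close> below 1. Solving \<open>(s - 1) / (s + 1) \<le> z m\<close> for
  \<open>s\<close> gives the bound.\<close>

lemma inv_stereo_image_closed:
  assumes "closed B" "north_pole m \<notin> B"
  obtains R where "\<And>x. inv_stereo m x \<in> B \<Longrightarrow> norm_sq m x \<le> R"
proof (cases "SS m \<inter> B = {}")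
  case True
  then show ?thesis
    using that inv_stereo_in_nsphere by blast
next
  case False
  have "compact (SS m \<inter> B)"
    using assms compact_nsphere by (simp add: compact_Int_closed)
  then obtain z where z: "z \<in> SS m" "z \<in> B" and max: "\<And>y. y \<in> SS m \<inter> B \<Longrightarrow> y m \<le> z m"
    using continuous_attains_sup [OF _ False continuous_on_coordinate [of _ m]] by auto
  have "z m < 1"
    using z assms north_pole_iff [OF z(1)] nsphere_coordinate_le_1 [OF z(1), of m] by force
  have "norm_sq m x \<le> (1 + z m) / (1 - z m)" if "inv_stereo m x \<in> B" for x
  proof -
    have "(norm_sq m x - 1) / (norm_sq m x + 1) \<le> z m"
      using max [of "inv_stereo m x"] that inv_stereo_in_nsphere [of m x] by (simp add: inv_stereo_alt)
    then have "norm_sq m x - 1 \<le> z m * (norm_sq m x + 1)"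
      by (simp add: divide_le_eq)
    then show ?thesis
      using \<open>z m < 1\<close> by (simp add: field_simps)
  qed
  then show ?thesis using that by blast
qed

text \<open>
  A partial map of \<open>EE m\<close> that is proper as a map defined on the open set \<open>D\<close> extends continuously
  to the one-point compactification by sending the complement of \<open>D\<close> to the point at infinity.
\<close>

definition sphere_lift ::
    "nat \<Rightarrow> (nat \<Rightarrow> real) set \<Rightarrow> ((nat \<Rightarrow> real) \<Rightarrow> (nat \<Rightarrow> real)) \<Rightarrow> (nat \<Rightarrow> real) \<Rightarrow> (nat \<Rightarrow> real)" where
  "sphere_lift m D g y =
    (if y \<noteq> north_pole m \<and> stereo m y \<in> D then inv_stereo m (g (stereo m y)) else north_pole m)"

lemma sphere_lift_north_pole [simp]: "sphere_lift m D g (north_pole m) = north_pole m"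
  by (simp add: sphere_lift_def)

lemma sphere_lift_inv_stereo [simp]:
  "x \<in> EE m \<Longrightarrow>
    sphere_lift m D g (inv_stereo m x) = (if x \<in> D then inv_stereo m (g x) else north_pole m)"
  by (simp add: sphere_lift_def)

lemma sphere_lift_in_nsphere [simp]: "sphere_lift m D g y \<in> SS m"
  by (simp add: sphere_lift_def inv_stereo_in_nsphere)

lemma openin_stereo_preimage:
  assumes "openin (Euclidean_space m) D"
  shows "openin (top_of_set (SS m)) {y \<in> SS m. y \<noteq> north_pole m \<and> stereo m y \<in> D}"
proof -
  have "openin (top_of_set (SS m - {north_pole m})) ((SS m - {north_pole m}) \<inter> stereo m -` D)"
    using continuous_openin_preimage [OF continuous_on_stereo, where T = "EE m" and U = D] assms
    by (auto simp: openin_Euclidean_space_iff)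
  moreover have "openin (top_of_set (SS m)) (SS m - {north_pole m})"
    by (simp add: openin_diff)
  ultimately have "openin (top_of_set (SS m)) ((SS m - {north_pole m}) \<inter> stereo m -` D)"
    by (rule openin_trans)
  also have "(SS m - {north_pole m}) \<inter> stereo m -` D = {y \<in> SS m. y \<noteq> north_pole m \<and> stereo m y \<in> D}"
    by auto
  finally show ?thesis .
qed

text \<open>The parameter \<open>t\<close> makes this a criterion for homotopies; a single map is
  the case of a one-point \<open>T\<close>. Properness is asked jointly in \<open>t\<close> and
  \<open>x\<close>: it confines the points with values away from infinity to a compact set.\<close>

lemma continuous_on_sphere_lift:
  fixes T :: "real set" and g :: "real \<Rightarrow> (nat \<Rightarrow> real) \<Rightarrow> (nat \<Rightarrow> real)"
  assumes D: "openin (Euclidean_space m) D"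
    and g: "continuous_on (T \<times> D) (\<lambda>(t, x). g t x)"
    and proper: "\<And>R. compact {(t, x). t \<in> T \<and> x \<in> D \<and> norm_sq m (g t x) \<le> R}"
  shows "continuous_on (T \<times> SS m) (\<lambda>(t, y). sphere_lift m D (g t) y)"
proof (rule continuous_on_open_preimageI)
  fix B :: "(nat \<Rightarrow> real) set" assume B: "open B"
  have DE: "D \<subseteq> EE m"
    using D openin_subset by blast
  define V where "V = {y \<in> SS m. y \<noteq> north_pole m \<and> stereo m y \<in> D}"
  let ?f = "\<lambda>(t, y). sphere_lift m D (g t) y"
  let ?h = "\<lambda>(t, y). inv_stereo m (g t (stereo m y))"
  have V: "openin (top_of_set (T \<times> SS m)) (T \<times> V)"
    unfolding V_def by (intro openin_Times openin_stereo_preimage D) simp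
  show "openin (top_of_set (T \<times> SS m)) {p \<in> T \<times> SS m. ?f p \<in> B}"
  proof (cases "north_pole m \<in> B")
    \<comment> \<open>A set that misses infinity has its preimage inside
      \<open>T \<times> V\<close>, where the lift is a composite of continuous maps.\<close>
    case False
    have "continuous_on V (stereo m)"
      by (rule continuous_on_subset [OF continuous_on_stereo]) (auto simp: V_def)
    then have "continuous_on (T \<times> V) (\<lambda>p. (fst p, stereo m (snd p)))"
      by (intro continuous_on_Pair continuous_on_fst continuous_on_id
          continuous_on_compose2 [of V "stereo m" _ snd] continuous_on_snd) auto
    from continuous_on_compose2 [OF g this] have "continuous_on (T \<times> V) (\<lambda>p. g (fst p) (stereo m (snd p)))"
      by (force simp: V_def)
    then have "continuous_on (T \<times> V) ?h"
      unfolding case_prod_unfold by (rule continuous_on_inv_stereo)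
    then have "openin (top_of_set (T \<times> V)) ((T \<times> V) \<inter> ?h -` B)"
      using B continuous_openin_preimage_eq by blast
    then have "openin (top_of_set (T \<times> SS m)) ((T \<times> V) \<inter> ?h -` B)"
      using V openin_trans by blast
    moreover have "{p \<in> T \<times> SS m. ?f p \<in> B} = (T \<times> V) \<inter> ?h -` B"
      using False by (auto simp: V_def sphere_lift_def split: if_splits)
    ultimately show ?thesis by simp
  next
    case True
    obtain R where R: "\<And>x. inv_stereo m x \<in> - B \<Longrightarrow> norm_sq m x \<le> R"
      using inv_stereo_image_closed [of "- B" m] B True by auto
    \<comment> \<open>Values outside \<open>B\<close> have \<open>norm_sq\<close> at most
      \<open>R\<close>, so the complement of the preimage is cut out by the image \<open>?K\<close>
      of a compact set, which is closed.\<close>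
    define C where "C = {(t, x). t \<in> T \<and> x \<in> D \<and> norm_sq m (g t x) \<le> R}"
    have "continuous_on C (\<lambda>p. inv_stereo m (g (fst p) (snd p)))"
      by (rule continuous_on_inv_stereo, rule continuous_on_subset [OF g [unfolded case_prod_unfold]])
        (auto simp: C_def)
    then have "closedin (top_of_set C) (C \<inter> (\<lambda>p. inv_stereo m (g (fst p) (snd p))) -` (- B))"
      using B continuous_closedin_preimage by blast
    then have "compact (C \<inter> (\<lambda>p. inv_stereo m (g (fst p) (snd p))) -` (- B))"
      using closedin_compact proper C_def by blast
    then have "compact ((\<lambda>p. (fst p, inv_stereo m (snd p))) ` (C \<inter> (\<lambda>p. inv_stereo m (g (fst p) (snd p))) -` (- B)))"
      by (rule compact_continuous_image [rotated])
        (intro continuous_on_Pair continuous_on_fst continuous_on_snd continuous_on_id continuous_on_inv_stereo)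
    then have "closed ((\<lambda>p. (fst p, inv_stereo m (snd p))) ` (C \<inter> (\<lambda>p. inv_stereo m (g (fst p) (snd p))) -` (- B)))"
      (is "closed ?K") by (rule compact_imp_closed)
    then have "openin (top_of_set (T \<times> SS m)) (T \<times> SS m \<inter> (- ?K))"
      by (intro openin_open_Int) auto
    moreover have "{p \<in> T \<times> SS m. ?f p \<in> B} = T \<times> SS m \<inter> (- ?K)"
    proof (intro Set.set_eqI iffI)
      fix p assume p: "p \<in> {p \<in> T \<times> SS m. ?f p \<in> B}"
      have "p \<notin> ?K"
      proof
        assume "p \<in> ?K"
        then obtain t x where "p = (t, inv_stereo m x)" "(t, x) \<in> C" "inv_stereo m (g t x) \<notin> B"
          by auto
        with p DE show False by (auto simp: C_def subset_iff)
      qed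
      with p show "p \<in> T \<times> SS m \<inter> (- ?K)" by auto
    next
      fix p assume p: "p \<in> T \<times> SS m \<inter> (- ?K)"
      then obtain t y where ty: "p = (t, y)" "t \<in> T" "y \<in> SS m" by auto
      have "?f p \<in> B"
      proof (rule ccontr)
        assume n: "?f p \<notin> B"
        then have y: "y \<noteq> north_pole m" "stereo m y \<in> D" "inv_stereo m (g t (stereo m y)) \<notin> B"
          using True by (auto simp: ty sphere_lift_def split: if_splits)
        then have "(t, stereo m y) \<in> C" using ty R by (auto simp: C_def)
        then have "(t, inv_stereo m (stereo m y)) \<in> ?K"
          using y(3) by (intro image_eqI [of _ _ "(t, stereo m y)"]) auto
        then show False using p y ty by simp
      qed
      with p show "p \<in> {p \<in> T \<times> SS m. ?f p \<in> B}" by auto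
    qed
    ultimately show ?thesis by simp
  qed
qed

section \<open>Homotopy invariance and independence of the chosen extension\<close>

lemma Brouwer_degree2_homotopicI:
  assumes h: "continuous_on ({0..1} \<times> SS m) h" "h \<in> {0..1} \<times> SS m \<rightarrow> SS m"
    and f: "\<And>y. y \<in> SS m \<Longrightarrow> h (0::real, y) = f y" and g: "\<And>y. y \<in> SS m \<Longrightarrow> h (1, y) = g y"
  shows "Brouwer_degree2 m f = Brouwer_degree2 m g"
proof (rule Brouwer_degree2_homotopic)
  have "homotopic_with (\<lambda>x. True) (top_of_set (SS m)) (top_of_set (SS m)) f g"
    using assms by (subst homotopic_with) (auto simp: continuous_map_in_subtopology intro!: exI [of _ h])
  then show "homotopic_with (\<lambda>x. True) (nsphere m) (nsphere m) f g"
    using nsphere_eq [of m] by simp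
qed

definition proper_partial :: "nat \<Rightarrow> (nat \<Rightarrow> real) set \<Rightarrow> ((nat \<Rightarrow> real) \<Rightarrow> (nat \<Rightarrow> real)) \<Rightarrow> bool" where
  "proper_partial m D g \<longleftrightarrow> openin (Euclidean_space m) D \<and> continuous_on D g \<and> g \<in> D \<rightarrow> EE m \<and>
    (\<forall>R. compact {x \<in> D. norm_sq m (g x) \<le> R})"

lemma continuous_map_sphere_lift:
  assumes "proper_partial m D g"
  shows "continuous_map (nsphere m) (nsphere m) (sphere_lift m D g)"
proof -
  have "{(t::real, x). t \<in> {0} \<and> x \<in> D \<and> norm_sq m (g x) \<le> R} = {0} \<times> {x \<in> D. norm_sq m (g x) \<le> R}" for R
    by auto
  then have "continuous_on ({0} \<times> SS m) (\<lambda>(t::real, y). sphere_lift m D g y)"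
    using assms unfolding proper_partial_def case_prod_unfold
    by (intro continuous_on_sphere_lift [where g = "\<lambda>t. g", unfolded case_prod_unfold])
      (auto intro!: continuous_on_compose2 [of D g _ snd] continuous_on_snd compact_Times simp: case_prod_unfold)
  then have "continuous_on (SS m) ((\<lambda>(t::real, y). sphere_lift m D g y) \<circ> (\<lambda>y. (0, y)))"
    by (intro continuous_on_compose continuous_on_Pair continuous_on_const continuous_on_id)
      (auto elim: continuous_on_subset)
  then show ?thesis
    by (simp add: continuous_map_nsphere_iff o_def)
qed

text \<open>Off the common neighbourhood of the fibre, the segment between the two maps is taken in the
  stereographic chart from the south pole \<open>inv_stereo m 0\<close>.\<close>

lemma Brouwer_degree2_eq_near_fibre:
  assumes F: "continuous_map (nsphere m) (nsphere m) F" and F': "continuous_map (nsphere m) (nsphere m) F'"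
    and Z: "compact Z" "Z \<subseteq> W" and W: "openin (Euclidean_space m) W"
    and eq: "\<And>x. x \<in> W \<Longrightarrow> F (inv_stereo m x) = F' (inv_stereo m x)"
    and fib: "\<And>y. y \<in> SS m \<Longrightarrow> F y = inv_stereo m (\<lambda>i. 0) \<Longrightarrow> y \<in> inv_stereo m ` Z"
    and fib': "\<And>y. y \<in> SS m \<Longrightarrow> F' y = inv_stereo m (\<lambda>i. 0) \<Longrightarrow> y \<in> inv_stereo m ` Z"
  shows "Brouwer_degree2 m F = Brouwer_degree2 m F'"
proof -
  \<comment> \<open>Reflecting the height exchanges the poles, so \<open>stereo\<close> after
    \<open>flip\<close> is the chart that omits the south pole.\<close>
  define flip :: "(nat \<Rightarrow> real) \<Rightarrow> nat \<Rightarrow> real" where "flip = (\<lambda>x i. if i = m then - x i else x i)"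
  have flip_flip [simp]: "flip (flip y) = y" for y
    by (auto simp: flip_def)
  have flipS: "flip y \<in> SS m" if "y \<in> SS m" for y
    using continuous_map_nsphere_reflection [of m m] that unfolding flip_def continuous_map_def by auto
  have cont_flip: "continuous_on S (\<lambda>x. flip (f x))" if "continuous_on S f" for S :: "'c::topological_space set" and f
  proof (rule continuous_on_coordinatewise_then_product)
    show "continuous_on S (\<lambda>x. flip (f x) i)" for i
      using continuous_on_product_then_coordinatewise [OF that, of i]
      by (cases "i = m") (auto simp: flip_def intro: continuous_on_minus)
  qed
  have south: "flip (inv_stereo m (\<lambda>i. 0)) = north_pole m"
    by (auto simp: flip_def inv_stereo_alt norm_sq_def north_pole_def)
  define s where "s = inv_stereo m (\<lambda>i. 0)"
  have flip_ne: "flip y \<noteq> north_pole m" if "y \<noteq> s" for y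
    using that south flip_flip unfolding s_def by metis
  define O1 where "O1 = {y \<in> SS m. y \<noteq> north_pole m \<and> stereo m y \<in> W}"
  have O1: "openin (top_of_set (SS m)) O1"
    unfolding O1_def by (rule openin_stereo_preimage [OF W])
  define O2 where "O2 = SS m - inv_stereo m ` Z"
  have WE: "W \<subseteq> EE m"
    using W openin_subset by blast
  have O1_eq: "F y = F' y" if "y \<in> O1" for y
    using that eq [of "stereo m y"] by (auto simp: O1_def)
  have "closed (inv_stereo m ` Z)"
    using Z by (intro compact_imp_closed compact_continuous_image continuous_on_inv_stereo continuous_on_id)
  then have O2: "openin (top_of_set (SS m)) O2"
    unfolding O2_def by (simp add: Diff_eq openin_open_Int open_Compl)
  have O12: "SS m = O1 \<union> O2"
    using Z WE inv_stereo_in_nsphere by (auto simp: O1_def O2_def subset_iff)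
  have FS: "F y \<in> SS m" "F' y \<in> SS m" if "y \<in> SS m" for y
    using F F' that by (auto simp: continuous_map_nsphere_iff)
  have Fs: "F y \<noteq> s" "F' y \<noteq> s" if "y \<in> O2" for y
    using that fib fib' by (auto simp: O2_def s_def)
  define k where "k = (\<lambda>(t::real, y). flip (inv_stereo m (\<lambda>i.
    (1 - t) * stereo m (flip (F y)) i + t * stereo m (flip (F' y)) i)))"
  have contF: "continuous_on ({0..1} \<times> O1) (\<lambda>p. F (snd p))"
    using F by (intro continuous_on_compose2 [of "SS m" F _ snd] continuous_on_snd continuous_on_id)
      (auto simp: continuous_map_nsphere_iff O1_def)
  have stereo_cont: "continuous_on ({0..1} \<times> O2) (\<lambda>p. stereo m (flip (G (snd p))))"
    if "continuous_on (SS m) G" "\<And>y. y \<in> O2 \<Longrightarrow> G y \<noteq> s" "G \<in> SS m \<rightarrow> SS m" for G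
  proof -
    have "continuous_on ({0..1} \<times> O2) (\<lambda>p. flip (G (snd p)))"
      by (intro cont_flip continuous_on_compose2 [OF that(1), of _ snd] continuous_on_snd continuous_on_id)
        (auto simp: O2_def)
    then show ?thesis
      by (rule continuous_on_compose2 [OF continuous_on_stereo])
        (use that flip_ne flipS in \<open>auto simp: O2_def Pi_iff\<close>)
  qed
  have cF: "continuous_on ({0..1} \<times> O2) (\<lambda>p. stereo m (flip (F (snd p))))"
    and cF': "continuous_on ({0..1} \<times> O2) (\<lambda>p. stereo m (flip (F' (snd p))))"
    using F F' Fs by (auto intro!: stereo_cont simp: continuous_map_nsphere_iff)
  have contk: "continuous_on ({0..1} \<times> O2) k"
    unfolding k_def case_prod_unfold
  proof (intro cont_flip continuous_on_inv_stereo, rule continuous_on_coordinatewise_then_product)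
    fix i
    show "continuous_on ({0..1} \<times> O2) (\<lambda>p. (1 - fst p) * stereo m (flip (F (snd p))) i
        + fst p * stereo m (flip (F' (snd p))) i)"
      using continuous_on_product_then_coordinatewise [OF cF, of i]
        continuous_on_product_then_coordinatewise [OF cF', of i]
      by (intro continuous_on_add continuous_on_mult continuous_on_diff continuous_on_fst
          continuous_on_id continuous_on_const)
  qed
  \<comment> \<open>On the overlap of \<open>O1\<close> and \<open>O2\<close> the two maps coincide,
    the segment between them is constant, and the two pieces of the homotopy glue.\<close>
  have k_eq: "k (t, y) = F y" if "y \<in> O1" "y \<in> O2" for t y
  proof -
    have "(\<lambda>i. (1 - t) * stereo m (flip (F y)) i + t * stereo m (flip (F' y)) i) = stereo m (flip (F y))"
      using O1_eq [OF that(1)] by (simp add: algebra_simps)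
    then show ?thesis
      using that Fs flip_ne FS flipS by (simp add: k_def O2_def)
  qed
  let ?h = "\<lambda>p. if snd p \<in> O1 then F (snd p) else k p"
  show ?thesis
  proof (rule Brouwer_degree2_homotopicI)
    have "{0..1} \<times> SS m = ({0..1} \<times> O1) \<union> ({0..1::real} \<times> O2)"
      unfolding O12 by auto
    moreover have "openin (top_of_set ({0..1} \<times> SS m)) ({0..1::real} \<times> O1)"
      "openin (top_of_set ({0..1} \<times> SS m)) ({0..1::real} \<times> O2)"
      by (intro openin_Times O1 O2; simp)+
    ultimately show "continuous_on ({0..1} \<times> SS m) ?h"
      using continuous_on_cases_local_open [of "{0..1} \<times> O1" "{0..1::real} \<times> O2" "\<lambda>p. F (snd p)" k "\<lambda>p. snd p \<in> O1"]
        contF contk k_eq by auto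
    show "?h \<in> {0..1} \<times> SS m \<rightarrow> SS m"
      using FS flipS inv_stereo_in_nsphere by (auto simp: k_def)
    fix y assume y: "y \<in> SS m"
    show "?h (0, y) = F y"
      using y O12 Fs flip_ne FS flipS by (auto simp: k_def)
    show "?h (1, y) = F' y"
      using y O12 Fs flip_ne FS flipS O1_eq by (auto simp: k_def)
  qed
qed

text \<open>This makes the definite description computable: two extensions agree on the intersection
  of their neighbourhoods, which still contains the compact fibre, and neither takes the value
  elsewhere.\<close>

lemma brouwer_degree_eqI:
  assumes ext: "sphere_extension m f U (\<lambda>i. 0) F" and Z: "compact {x \<in> U. f x = (\<lambda>i. 0)}"
  shows "brouwer_degree m f U (\<lambda>i. 0) = Brouwer_degree2 m F"
  unfolding brouwer_degree_def
proof (rule the_equality)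
  fix k assume "\<exists>G. sphere_extension m f U (\<lambda>i. 0) G \<and> k = Brouwer_degree2 m G"
  then obtain G where G: "sphere_extension m f U (\<lambda>i. 0) G" "k = Brouwer_degree2 m G" by blast
  from ext obtain W where W: "openin (Euclidean_space m) W" "{x \<in> U. f x = (\<lambda>i. 0)} \<subseteq> W"
      "\<And>x. x \<in> W \<Longrightarrow> F (inv_stereo m x) = inv_stereo m (f x)"
    by (auto simp: sphere_extension_def)
  from G(1) obtain W' where W': "openin (Euclidean_space m) W'" "{x \<in> U. f x = (\<lambda>i. 0)} \<subseteq> W'"
      "\<And>x. x \<in> W' \<Longrightarrow> G (inv_stereo m x) = inv_stereo m (f x)"
    by (auto simp: sphere_extension_def)
  show "k = Brouwer_degree2 m F"
    unfolding G(2)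
  proof (rule Brouwer_degree2_eq_near_fibre [OF _ _ Z, where W = "W \<inter> W'"])
    show "openin (Euclidean_space m) (W \<inter> W')"
      using W W' by blast
  qed (use ext G(1) W W' in \<open>auto simp: sphere_extension_def\<close>)
qed (use ext in blast)

section \<open>Existence of proper representatives\<close>

lemma continuous_on_divide_fun:
  fixes f :: "'a::topological_space \<Rightarrow> nat \<Rightarrow> real"
  assumes "continuous_on S f" "continuous_on S r" "\<And>x. x \<in> S \<Longrightarrow> r x \<noteq> 0"
  shows "continuous_on S (\<lambda>x i. f x i / r x)"
  using assms by (intro continuous_on_coordinatewise_then_product)
    (auto intro: continuous_on_divide continuous_on_product_then_coordinatewise)

lemma norm_sq_divide: "norm_sq m (\<lambda>i. x i / r) = norm_sq m x / r\<^sup>2"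
  by (simp add: norm_sq_def power_divide sum_divide_distrib)

lemma cutoff_function:
  assumes Z: "compact Z" "Z \<subseteq> U" and U: "openin (Euclidean_space m) U"
  obtains \<rho> :: "(nat \<Rightarrow> real) \<Rightarrow> real" and W K where "continuous_on UNIV \<rho>" "\<forall>x. 0 \<le> \<rho> x"
    "openin (Euclidean_space m) W" "Z \<subseteq> W" "W \<subseteq> K" "compact K" "K \<subseteq> U"
    "\<forall>x\<in>W. \<rho> x = 1" "\<forall>x\<in>EE m. 0 < \<rho> x \<longrightarrow> x \<in> K"
proof (cases "Z = {}")
  \<comment> \<open>The empty set is split off because \<open>infdist x {}\<close> is 0 by
    convention and no maximum of \<open>norm_sq\<close> exists on it.\<close>
  case True
  show ?thesis
    by (rule that [of "\<lambda>x. 0" "{}" "{}"]) (use True in auto)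
next
  case False
  obtain O1 where O1: "open O1" "U = EE m \<inter> O1"
    using U by (auto simp: openin_Euclidean_space_iff openin_open)
  obtain z where z: "\<And>x. x \<in> Z \<Longrightarrow> norm_sq m x \<le> norm_sq m z"
    using continuous_attains_sup [OF Z(1) False continuous_on_norm_sq [of _ _ m, OF continuous_on_id]] by auto
  define R where "R = norm_sq m z + 1"
  \<comment> \<open>The metric of the function space only induces the product topology, and its
    balls need not be bounded in \<open>norm_sq\<close>. The norm bound is therefore made part of
    the open set around \<open>Z\<close>.\<close>
  have "open {x. norm_sq m x < R}"
    by (intro open_Collect_less continuous_on_norm_sq continuous_on_id continuous_on_const)
  then have "open (O1 \<inter> {x. norm_sq m x < R})"
    using O1 by blast
  moreover have "Z \<subseteq> O1 \<inter> {x. norm_sq m x < R}"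
    using z Z O1 by (force simp: R_def)
  ultimately obtain e where e: "e > 0" "(\<Union>x\<in>Z. ball x e) \<subseteq> O1 \<inter> {x. norm_sq m x < R}"
    using compact_subset_open_imp_ball_epsilon_subset [OF Z(1)] by blast
  \<comment> \<open>The affine function \<open>2 - 3 * infdist x Z / e\<close> is 1 at distance
    \<open>e / 3\<close> and 0 at distance \<open>2 * e / 3\<close>; the radii of \<open>W\<close>
    and \<open>K\<close> are these two.\<close>
  define \<rho> where "\<rho> = (\<lambda>x. max 0 (min 1 (2 - 3 * infdist x Z / e)))"
  define W where "W = EE m \<inter> {x. infdist x Z < e / 3}"
  define K where "K = EE m \<inter> {x. infdist x Z \<le> 2 * e / 3}"
  have near: "x \<in> O1 \<and> norm_sq m x < R" if "infdist x Z < e" for x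
  proof -
    have "\<exists>z\<in>Z. dist x z < e"
    proof (rule ccontr)
      assume "\<not> ?thesis"
      then have "e \<le> infdist x Z"
        using False by (auto simp: infdist_notempty not_less intro!: cINF_greatest)
      with that show False by simp
    qed
    then obtain z where "z \<in> Z" "x \<in> ball z e" by (auto simp: dist_commute)
    then show ?thesis using e by blast
  qed
  have near': "x \<in> O1" "norm_sq m x \<le> R" if "infdist x Z \<le> 2 * e / 3" for x
  proof -
    have "infdist x Z < e" using that e(1) by simp
    then show "x \<in> O1" "norm_sq m x \<le> R" using near [of x] by auto
  qed
  show ?thesis
  proof (rule that [of \<rho> W K])
    show "continuous_on UNIV \<rho>"
      unfolding \<rho>_def using e(1)
      by (intro continuous_on_max continuous_on_min continuous_on_diff continuous_on_divide
          continuous_on_mult continuous_on_infdist continuous_on_const continuous_on_id) auto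
    have "open {x. infdist x Z < e / 3}"
      by (intro open_Collect_less continuous_on_infdist continuous_on_id continuous_on_const)
    then show "openin (Euclidean_space m) W"
      unfolding W_def openin_Euclidean_space_iff by (rule openin_open_Int)
    show "Z \<subseteq> W"
      using Z(2) O1 e by (auto simp: W_def)
    show "W \<subseteq> K"
      using e by (auto simp: W_def K_def)
    have "closed {x. infdist x Z \<le> 2 * e / 3}"
      by (intro closed_Collect_le continuous_on_infdist continuous_on_id continuous_on_const)
    then have "compact ({x \<in> EE m. norm_sq m x \<le> R} \<inter> {x. infdist x Z \<le> 2 * e / 3})"
      by (intro compact_Int_closed [OF compact_norm_sq_le])
    also have "{x \<in> EE m. norm_sq m x \<le> R} \<inter> {x. infdist x Z \<le> 2 * e / 3} = K"
      using near' by (auto simp: K_def)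
    finally show "compact K" .
    show "K \<subseteq> U"
      using near' O1 by (auto simp: K_def)
    show "\<forall>x\<in>W. \<rho> x = 1"
      using e by (auto simp: W_def \<rho>_def field_simps)
    show "\<forall>x\<in>EE m. 0 < \<rho> x \<longrightarrow> x \<in> K"
    proof (intro ballI impI)
      fix x assume that: "x \<in> EE m" "0 < \<rho> x"
      have "0 < 2 - 3 * infdist x Z / e"
        using that(2) by (simp add: \<rho>_def less_max_iff_disj)
      then show "x \<in> K" using that(1) e(1) by (simp add: K_def field_simps)
    qed
    show "\<forall>x. 0 \<le> \<rho> x" by (simp add: \<rho>_def)
  qed
qed

text \<open>Dividing by a cutoff function makes a map with compact zero set proper without moving its
  zeros.\<close>

lemma proper_partial_homotopy:
  fixes f :: "real \<Rightarrow> (nat \<Rightarrow> real) \<Rightarrow> (nat \<Rightarrow> real)"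
  assumes U: "openin (Euclidean_space m) U"
    and f: "continuous_on ({0..1} \<times> U) (\<lambda>(t, x). f t x)"
    and fE: "\<And>t x. t \<in> {0..1} \<Longrightarrow> x \<in> U \<Longrightarrow> f t x \<in> EE m"
    and Z: "compact Z" "\<And>t. t \<in> {0..1} \<Longrightarrow> {x \<in> U. f t x = (\<lambda>i. 0)} = Z"
  obtains D g W where "\<forall>t\<in>{0..1}. proper_partial m D (g t)"
    "openin (Euclidean_space m) W" "Z \<subseteq> W" "W \<subseteq> D" "D \<subseteq> U"
    "\<forall>t. \<forall>x\<in>W. g t x = f t x"
    "\<forall>t\<in>{0..1}. \<forall>x\<in>D. g t x = (\<lambda>i. 0) \<longrightarrow> x \<in> Z"
    "Brouwer_degree2 m (sphere_lift m D (g 0)) = Brouwer_degree2 m (sphere_lift m D (g 1))"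
proof -
  have "Z \<subseteq> U" using Z(2) [of 0] by auto
  obtain \<rho> :: "(nat \<Rightarrow> real) \<Rightarrow> real" and W K where \<rho>: "continuous_on UNIV \<rho>" "\<forall>x. 0 \<le> \<rho> x"
    and W: "openin (Euclidean_space m) W" "Z \<subseteq> W" "W \<subseteq> K"
    and K: "compact K" "K \<subseteq> U" and one: "\<forall>x\<in>W. \<rho> x = 1"
    and pos: "\<forall>x\<in>EE m. 0 < \<rho> x \<longrightarrow> x \<in> K"
    by (rule cutoff_function [OF Z(1) \<open>Z \<subseteq> U\<close> U])
  have UE: "U \<subseteq> EE m" using U openin_subset by blast
  define D where "D = EE m \<inter> {x. 0 < \<rho> x}"
  \<comment> \<open>On \<open>W\<close> the divisor is 1, so nothing changes near the zeros. Towards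
    the boundary of \<open>D\<close> the divisor tends to 0 while \<open>f\<close> stays away from
    0, so the quotient tends to infinity.\<close>
  define g where "g = (\<lambda>t x i. f t x i / \<rho> x)"
  have "open {x. 0 < \<rho> x}"
    using \<rho>(1) by (intro open_Collect_less continuous_on_const)
  then have D: "openin (Euclidean_space m) D"
    unfolding D_def openin_Euclidean_space_iff by (rule openin_open_Int)
  have DU: "D \<subseteq> U" using pos K by (auto simp: D_def)
  have "continuous_on ({0..1} \<times> D) (\<lambda>p. f (fst p) (snd p))"
    by (rule continuous_on_subset [OF f [unfolded case_prod_unfold]]) (use DU in auto)
  moreover have "continuous_on ({0..1} \<times> D) (\<lambda>p. \<rho> (snd p))"
    by (rule continuous_on_compose2 [OF \<rho>(1) continuous_on_snd [OF continuous_on_id]]) auto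
  ultimately have contg: "continuous_on ({0..1} \<times> D) (\<lambda>(t, x). g t x)"
    unfolding g_def case_prod_unfold by (rule continuous_on_divide_fun) (auto simp: D_def)
  have compact: "compact {(t, x). t \<in> {0..1} \<and> x \<in> D \<and> norm_sq m (g t x) \<le> R}" for R
  proof -
    have "continuous_on ({0..1} \<times> K) (\<lambda>p. f (fst p) (snd p))"
      by (rule continuous_on_subset [OF f [unfolded case_prod_unfold]]) (use K in auto)
    moreover have "continuous_on ({0..1::real} \<times> K) (\<lambda>p. \<rho> (snd p))"
      by (rule continuous_on_compose2 [OF \<rho>(1) continuous_on_snd [OF continuous_on_id]]) auto
    \<comment> \<open>Multiplying out the denominator describes the sublevel set on the compact set
      \<open>K\<close>. Points of \<open>K\<close> with \<open>\<rho> x = 0\<close> are not zeros of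
      \<open>f\<close>, since the zeros lie in \<open>W\<close>; hence \<open>?q\<close> is positive
      there and no spurious points enter.\<close>
    ultimately have "continuous_on ({0..1} \<times> K) (\<lambda>p. norm_sq m (f (fst p) (snd p)) - R * (\<rho> (snd p))\<^sup>2)"
      (is "continuous_on ?C ?q")
      by (intro continuous_on_diff continuous_on_norm_sq continuous_on_mult continuous_on_power
          continuous_on_const)
    then have "closedin (top_of_set ?C) (?C \<inter> ?q -` {..0})"
      by (rule continuous_closedin_preimage) simp
    moreover have "compact ?C"
      using K by (intro compact_Times) auto
    ultimately have "compact (?C \<inter> ?q -` {..0})"
      using closedin_compact by blast
    also have "?C \<inter> ?q -` {..0} = {(t, x). t \<in> {0..1} \<and> x \<in> D \<and> norm_sq m (g t x) \<le> R}"
    proof -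
      have *: "x \<in> K \<and> norm_sq m (f t x) - R * (\<rho> x)\<^sup>2 \<le> 0 \<longleftrightarrow> x \<in> D \<and> norm_sq m (g t x) \<le> R"
        if t: "t \<in> {0..1}" for t x
      proof (cases "x \<in> D")
        case True
        then show ?thesis
          using pos by (auto simp: D_def g_def norm_sq_divide divide_le_eq mult.commute)
      next
        case False
        have "norm_sq m (f t x) - R * (\<rho> x)\<^sup>2 > 0" if "x \<in> K"
        proof -
          have "\<rho> x = 0" using False that K UE \<rho>(2) [rule_format, of x] by (auto simp: D_def)
          moreover have "f t x \<noteq> (\<lambda>i. 0)"
            using Z(2) [OF t] W one \<open>\<rho> x = 0\<close> that K by auto
          ultimately show ?thesis
            using norm_sq_eq_0 [OF fE [OF t, of x]] norm_sq_nonneg [of m "f t x"] that K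
            by (auto simp: less_le)
        qed
        with False show ?thesis by auto
      qed
      show ?thesis
      proof (rule Set.set_eqI)
        fix p
        show "p \<in> ?C \<inter> ?q -` {..0} \<longleftrightarrow> p \<in> {(t, x). t \<in> {0..1} \<and> x \<in> D \<and> norm_sq m (g t x) \<le> R}"
          using * [of "fst p" "snd p"] by (cases p) auto
      qed
    qed
    finally show ?thesis .
  qed
  have proper: "proper_partial m D (g t)" if t: "t \<in> {0..1}" for t
    unfolding proper_partial_def
  proof (intro conjI allI D)
    show "continuous_on D (g t)"
      by (rule continuous_on_compose2 [OF contg, of D "\<lambda>x. (t, x)", unfolded prod.case])
        (use t in \<open>auto intro: continuous_on_Pair\<close>)
    show "g t \<in> D \<rightarrow> EE m"
      using fE [OF t] DU by (fastforce simp: g_def in_topspace_Euclidean_space)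
    fix R
    have "compact (snd ` ({(t, x). t \<in> {0..1} \<and> x \<in> D \<and> norm_sq m (g t x) \<le> R} \<inter> ({t} \<times> UNIV)))"
      by (intro compact_continuous_image continuous_on_snd continuous_on_id compact_Int_closed compact
          closed_Times) auto
    also have "snd ` ({(t, x). t \<in> {0..1} \<and> x \<in> D \<and> norm_sq m (g t x) \<le> R} \<inter> ({t} \<times> UNIV))
        = {x \<in> D. norm_sq m (g t x) \<le> R}"
      using t by force
    finally show "compact {x \<in> D. norm_sq m (g t x) \<le> R}" .
  qed
  have "Brouwer_degree2 m (sphere_lift m D (g 0)) = Brouwer_degree2 m (sphere_lift m D (g 1))"
    by (rule Brouwer_degree2_homotopicI [OF continuous_on_sphere_lift [OF D contg compact]]) auto
  moreover have "W \<subseteq> D"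
    using W one K UE by (auto simp: D_def)
  moreover have "x \<in> Z" if "t \<in> {0..1}" "x \<in> D" "g t x = (\<lambda>i. 0)" for t x
  proof -
    have "f t x = (\<lambda>i. 0)"
      using that by (auto simp: g_def D_def fun_eq_iff)
    then show ?thesis using Z(2) [OF that(1)] that(2) DU by auto
  qed
  moreover have "g t x = f t x" if "x \<in> W" for t x
    using one that by (simp add: g_def)
  ultimately show ?thesis
    using that [of D g W] proper W DU by blast
qed

lemma inv_stereo_eq_0:
  assumes "x \<in> EE m" shows "inv_stereo m x = inv_stereo m (\<lambda>i. 0) \<longleftrightarrow> x = (\<lambda>i. 0)"
  using assms inv_stereo_inj [of x m "\<lambda>i. 0"] by (simp add: in_topspace_Euclidean_space)

text \<open>Infinity and the complement of \<open>D\<close> go to the north pole, so the fibre of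
  the lift over the origin consists of the zeros of \<open>g\<close> alone. The assumption is
  continuity of the lift rather than properness of \<open>g\<close>, which suits composites of
  lifts.\<close>

lemma brouwer_degree_sphere_lift:
  assumes cont: "continuous_map (nsphere m) (nsphere m) (sphere_lift m D g)"
    and D: "D \<subseteq> EE m" "g \<in> D \<rightarrow> EE m"
    and W: "openin (Euclidean_space m) W" "W \<subseteq> D" "W \<subseteq> U" "{x \<in> U. f x = (\<lambda>i. 0)} \<subseteq> W"
    and eq: "\<And>x. x \<in> W \<Longrightarrow> g x = f x"
    and zero: "\<And>x. x \<in> D \<Longrightarrow> g x = (\<lambda>i. 0) \<Longrightarrow> x \<in> U \<and> f x = (\<lambda>i. 0)"
    and Z: "compact {x \<in> U. f x = (\<lambda>i. 0)}"
  shows "brouwer_degree m f U (\<lambda>i. 0) = Brouwer_degree2 m (sphere_lift m D g)"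
proof (rule brouwer_degree_eqI [OF _ Z])
  have "\<forall>x\<in>W. sphere_lift m D g (inv_stereo m x) = inv_stereo m (f x)"
    using W D eq by (auto simp: subset_iff)
  moreover have "y \<in> inv_stereo m ` {x \<in> U. f x = (\<lambda>i. 0)}"
    if y: "y \<in> SS m" "sphere_lift m D g y = inv_stereo m (\<lambda>i. 0)" for y
  proof -
    have "y \<noteq> north_pole m \<and> stereo m y \<in> D \<and> inv_stereo m (g (stereo m y)) = inv_stereo m (\<lambda>i. 0)"
      using y inv_stereo_neq_north_pole [of m "\<lambda>i. 0", symmetric] by (auto simp: sphere_lift_def split: if_splits)
    then have "y \<noteq> north_pole m" "stereo m y \<in> U \<and> f (stereo m y) = (\<lambda>i. 0)"
      using D zero by (auto simp: inv_stereo_eq_0 Pi_iff)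
    then show ?thesis
      using inv_stereo_stereo [OF y(1)] by (metis (mono_tags, lifting) image_eqI mem_Collect_eq)
  qed
  ultimately show "sphere_extension m f U (\<lambda>i. 0) (sphere_lift m D g)"
    unfolding sphere_extension_def using cont W by auto
qed

text \<open>The lift with empty domain is an extension here; it is constant and so has degree
  0.\<close>

lemma brouwer_degree_no_zero:
  assumes "\<And>x. x \<in> U \<Longrightarrow> f x \<noteq> (\<lambda>i. 0)"
  shows "brouwer_degree m f U (\<lambda>i. 0) = 0"
proof -
  have eq: "sphere_lift m {} g = (\<lambda>y. north_pole m)" for g
    by (simp add: sphere_lift_def fun_eq_iff)
  have empty: "{x \<in> U. f x = (\<lambda>i. 0)} = {}"
    using assms by auto
  have "brouwer_degree m f U (\<lambda>i. 0) = Brouwer_degree2 m (sphere_lift m {} f)"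
    by (rule brouwer_degree_sphere_lift [where W = "{}"]) (auto simp only: eq empty compact_empty
        continuous_map_const, auto)
  then show ?thesis
    by (simp add: eq Brouwer_degree2_const)
qed

section \<open>Permutations of coordinates and added coordinates\<close>

text \<open>A point that leaves the first domain is already at infinity, which every lift
  fixes.\<close>

lemma sphere_lift_compose:
  assumes "D \<subseteq> EE m" "g \<in> D \<rightarrow> EE m" "y \<in> SS m"
  shows "sphere_lift m D' g' (sphere_lift m D g y) = sphere_lift m {x \<in> D. g x \<in> D'} (g' \<circ> g) y"
  using assms by (auto simp: sphere_lift_def Pi_iff)

lemma sphere_lift_cong:
  assumes "D = D'" "\<And>x. x \<in> D' \<Longrightarrow> g x = g' x"
  shows "sphere_lift m D g y = sphere_lift m D' g' y"
  using assms by (auto simp: sphere_lift_def)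

lemma continuous_on_comp_fun:
  fixes p :: "nat \<Rightarrow> nat"
  shows "continuous_on S (\<lambda>y::nat \<Rightarrow> real. y \<circ> p)"
  unfolding o_def by (rule continuous_on_coordinatewise_then_product) (rule continuous_on_coordinate)

lemma continuous_map_nsphere_permute:
  assumes p: "p permutes {..m}"
  shows "continuous_map (nsphere m) (nsphere m) (\<lambda>y. y \<circ> p)"
  unfolding continuous_map_nsphere_iff
proof (intro conjI continuous_on_comp_fun Pi_I)
  fix y assume y: "y \<in> SS m"
  have "(\<Sum>i\<le>m. ((y \<circ> p) i)\<^sup>2) = (\<Sum>i\<le>m. (y i)\<^sup>2)"
    using sum.permute [OF p, of "\<lambda>i. (y i)\<^sup>2"] by (simp add: o_def)
  then show "y \<circ> p \<in> SS m"
    using y p by (auto simp: topspace_nsphere_iff permutes_def)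
qed

text \<open>This is the Householder reflection along \<open>w\<close>; in the expanded sum of
  squares the cross term cancels the quadratic one.\<close>

lemma reflection_in_nsphere:
  assumes y: "y \<in> SS m" and w: "(\<Sum>l\<le>m. (w l)\<^sup>2) \<noteq> 0" "\<forall>l>m. w l = 0"
  shows "(\<lambda>k. y k - 2 * (\<Sum>l\<le>m. w l * y l) / (\<Sum>l\<le>m. (w l)\<^sup>2) * w k) \<in> SS m"
proof -
  let ?q = "\<Sum>l\<le>m. (w l)\<^sup>2" and ?s = "\<Sum>l\<le>m. w l * y l"
  let ?c = "2 * ?s / ?q"
  have "(\<Sum>k\<le>m. (y k - ?c * w k)\<^sup>2) = (\<Sum>k\<le>m. (y k)\<^sup>2 - 2 * ?c * (w k * y k) + ?c\<^sup>2 * (w k)\<^sup>2)"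
    by (intro sum.cong refl) (simp add: power2_eq_square algebra_simps)
  also have "\<dots> = (\<Sum>k\<le>m. (y k)\<^sup>2) - 2 * ?c * ?s + ?c\<^sup>2 * ?q"
    by (simp only: sum.distrib sum_subtractf sum_distrib_left)
  also have "?c\<^sup>2 * ?q = 2 * ?c * ?s"
    using w(1) by (simp add: power2_eq_square)
  finally show ?thesis
    using y w(2) by (simp add: topspace_nsphere_iff)
qed

text \<open>A transposition is the reflection along \<open>e\<^sub>i - e\<^sub>j\<close>, which is deformed to \<open>e\<^sub>0\<close> through
  nonzero vectors.\<close>

lemma Brouwer_degree2_transpose:
  assumes "i \<le> m" "j \<le> m" "i \<noteq> j"
  shows "Brouwer_degree2 m (\<lambda>y. y \<circ> Transposition.transpose i j) = -1"
proof -
  define w :: "real \<Rightarrow> nat \<Rightarrow> real" where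
    "w = (\<lambda>t k. (1 - t) * (of_bool (k = i) - of_bool (k = j)) + t * of_bool (k = 0))"
  define q where "q = (\<lambda>t. \<Sum>l\<le>m. (w t l)\<^sup>2)"
  define s where "s = (\<lambda>t y. \<Sum>l\<le>m. w t l * y l)"
  define h where "h = (\<lambda>p k. snd p k - 2 * s (fst p) (snd p) / q (fst p) * w (fst p) k)"
  have q: "q t \<noteq> 0" for t
  proof
    assume "q t = 0"
    then have z: "w t l = 0" if "l \<le> m" for l
      using that by (simp add: q_def sum_nonneg_eq_0_iff)
    \<comment> \<open>Whichever of \<open>i\<close> and \<open>j\<close> is not 0 has coordinate
      \<open>1 - t\<close> up to sign. This forces \<open>t = 1\<close>, where coordinate 0 is
      1.\<close>
    from z [of i] z [of j] z [of 0] assms show False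
      by (auto simp: w_def of_bool_def split: if_splits)
  qed
  have contw: "continuous_on S (\<lambda>p. w (fst p) k)" for S :: "(real \<times> (nat \<Rightarrow> real)) set" and k
    unfolding w_def by (intro continuous_on_add continuous_on_mult continuous_on_diff continuous_on_fst
        continuous_on_id continuous_on_const)
  have conty: "continuous_on S (\<lambda>p. snd p k)" for S :: "(real \<times> (nat \<Rightarrow> real)) set" and k
    by (rule continuous_on_product_then_coordinatewise) (intro continuous_on_snd continuous_on_id)
  have "Brouwer_degree2 m (\<lambda>y. y \<circ> Transposition.transpose i j)
      = Brouwer_degree2 m (\<lambda>x i. if i = 0 then - x i else x i)"
  proof (rule Brouwer_degree2_homotopicI)
    show "continuous_on ({0..1} \<times> SS m) h"
      unfolding h_def s_def q_def
      by (rule continuous_on_coordinatewise_then_product,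
          intro continuous_on_diff continuous_on_mult continuous_on_divide continuous_on_const
            continuous_on_sum continuous_on_power contw conty)
        (use q in \<open>auto simp: q_def\<close>)
    show "h \<in> {0..1} \<times> SS m \<rightarrow> SS m"
    proof (rule Pi_I)
      fix p assume "p \<in> {0..1::real} \<times> SS m"
      then show "h p \<in> SS m"
        unfolding h_def s_def q_def using assms q [of "fst p"]
        by (intro reflection_in_nsphere) (auto simp: q_def w_def)
    qed
    fix y assume y: "y \<in> SS m"
    have w0: "w 0 k = of_bool (k = i) - of_bool (k = j)" and w1: "w 1 k = of_bool (k = 0)" for k
      by (simp_all add: w_def)
    have "q 0 = (\<Sum>l\<le>m. of_bool (l = i) + of_bool (l = j))"
      unfolding q_def w0 using assms by (intro sum.cong) (auto simp: of_bool_def)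
    then have q0: "q 0 = 2"
      using assms by (simp add: sum.distrib of_bool_def)
    have s0: "s 0 y = y i - y j"
      using assms by (simp add: s_def w0 left_diff_distrib sum_subtractf of_bool_def if_distrib [of "\<lambda>x. x * _"] cong: if_cong)
    show "h (0, y) = y \<circ> Transposition.transpose i j"
      using assms by (auto simp: h_def q0 s0 w0 Transposition.transpose_def fun_eq_iff diff_divide_distrib)
    have q1: "q 1 = 1"
      by (simp add: q_def w1 of_bool_def if_distrib [of "\<lambda>x. x ^ 2"] cong: if_cong)
    have s1: "s 1 y = y 0"
      by (simp add: s_def w1 of_bool_def if_distrib [of "\<lambda>x. x * _"] cong: if_cong)
    show "h (1, y) = (\<lambda>i. if i = 0 then - y i else y i)"
      by (auto simp: h_def q1 s1 w1 fun_eq_iff)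
  qed
  then show ?thesis
    by (simp add: Brouwer_degree2_reflection)
qed

text \<open>Precomposition reverses the order of the factors, which is harmless because integers
  commute.\<close>

lemma Brouwer_degree2_permute_compose:
  assumes "p permutes {..m}" "q permutes {..m}"
  shows "Brouwer_degree2 m (\<lambda>y. y \<circ> (p \<circ> q))
      = Brouwer_degree2 m (\<lambda>y. y \<circ> p) * Brouwer_degree2 m (\<lambda>y. y \<circ> q)"
proof -
  have "(\<lambda>y. y \<circ> (p \<circ> q)) = (\<lambda>y. y \<circ> q) \<circ> (\<lambda>y::nat \<Rightarrow> real. y \<circ> p)"
    by (auto simp: fun_eq_iff)
  then show ?thesis
    using Brouwer_degree2_compose [OF continuous_map_nsphere_permute [OF assms(1)]
        continuous_map_nsphere_permute [OF assms(2)]] by (simp add: mult.commute)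
qed

text \<open>Conjugation multiplies the degree by the square of the degree of \<open>p\<close>, and
  \<open>p \<circ> p = id\<close> makes that square 1.\<close>

lemma Brouwer_degree2_involution_conj:
  assumes p: "p permutes {..m}" "p \<circ> p = id" and F: "continuous_map (nsphere m) (nsphere m) F"
  shows "continuous_map (nsphere m) (nsphere m) (\<lambda>y. F (y \<circ> p) \<circ> p)"
    and "Brouwer_degree2 m (\<lambda>y. F (y \<circ> p) \<circ> p) = Brouwer_degree2 m F"
proof -
  let ?p = "\<lambda>y::nat \<Rightarrow> real. y \<circ> p"
  have c: "continuous_map (nsphere m) (nsphere m) ?p"
    by (rule continuous_map_nsphere_permute [OF p(1)])
  have eq: "(\<lambda>y. F (y \<circ> p) \<circ> p) = ?p \<circ> (F \<circ> ?p)"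
    by (simp add: fun_eq_iff)
  show "continuous_map (nsphere m) (nsphere m) (\<lambda>y. F (y \<circ> p) \<circ> p)"
    unfolding eq by (rule continuous_map_compose [OF continuous_map_compose [OF c F] c])
  have "(\<lambda>y. y \<circ> (p \<circ> p)) = (id :: (nat \<Rightarrow> real) \<Rightarrow> nat \<Rightarrow> real)"
    unfolding p(2) by (simp add: fun_eq_iff)
  then have "Brouwer_degree2 m (\<lambda>y. y \<circ> (p \<circ> p)) = 1"
    by (simp only: Brouwer_degree2_id)
  then have "Brouwer_degree2 m ?p * Brouwer_degree2 m ?p = 1"
    by (simp add: Brouwer_degree2_permute_compose [OF p(1) p(1)])
  moreover have "Brouwer_degree2 m (?p \<circ> (F \<circ> ?p))
      = Brouwer_degree2 m ?p * (Brouwer_degree2 m F * Brouwer_degree2 m ?p)"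
    by (simp add: Brouwer_degree2_compose continuous_map_compose [OF c F] c F)
  ultimately show "Brouwer_degree2 m (\<lambda>y. F (y \<circ> p) \<circ> p) = Brouwer_degree2 m F"
    by (simp add: eq mult.left_commute mult.commute) 
qed

section \<open>Adding coordinates on which a map is the identity\<close>

definition first_coords :: "nat \<Rightarrow> (nat \<Rightarrow> real) \<Rightarrow> (nat \<Rightarrow> real)" where
  "first_coords d x = (\<lambda>i. if i < d then x i else 0)"

lemma first_coords_in_Euclidean_space [simp]: "first_coords d x \<in> EE d"
  by (simp add: first_coords_def in_topspace_Euclidean_space)

lemma first_coords_eq [simp]: "x \<in> EE d \<Longrightarrow> first_coords d x = x"
  by (auto simp: first_coords_def in_topspace_Euclidean_space)

lemma first_coords_first_coords [simp]: "d \<le> e \<Longrightarrow> first_coords d (first_coords e x) = first_coords d x"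
  by (auto simp: first_coords_def)

lemma continuous_on_first_coords: "continuous_on S (first_coords d)"
proof (rule continuous_on_coordinatewise_then_product)
  show "continuous_on S (\<lambda>x. first_coords d x i)" for i
    by (cases "i < d") (auto simp: first_coords_def intro: continuous_on_coordinate)
qed

lemma openin_first_coords_preimage:
  assumes "openin (Euclidean_space d) D"
  shows "openin (Euclidean_space m) {x \<in> EE m. first_coords d x \<in> D}"
  using continuous_openin_preimage [OF continuous_on_first_coords, of d "EE m" "EE d" D] assms
  by (simp add: openin_Euclidean_space_iff Int_def)

text \<open>The map is \<open>g \<times> id\<close>. Its squared norm is a sum of two nonnegative
  terms, so a sublevel set is a closed part of a sublevel set of \<open>g\<close> times a bounded
  interval, transported by the embedding \<open>?j\<close>.\<close>

lemma proper_partial_suspension: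
  assumes g: "proper_partial m D g"
  defines "D1 \<equiv> {x \<in> EE (Suc m). first_coords m x \<in> D}"
    and "g1 \<equiv> \<lambda>x i. if i < m then g (first_coords m x) i else x i"
  shows "proper_partial (Suc m) D1 g1"
proof -
  have DE: "D \<subseteq> EE m" and gD: "g \<in> D \<rightarrow> EE m" and contg: "continuous_on D g"
    and cg: "\<And>R. compact {x \<in> D. norm_sq m (g x) \<le> R}"
    using g openin_subset unfolding proper_partial_def by blast+
  have norm: "norm_sq (Suc m) (g1 x) = norm_sq m (g (first_coords m x)) + (x m)\<^sup>2" for x
    by (simp add: norm_sq_def g1_def)
  show ?thesis
    unfolding proper_partial_def
  proof (intro conjI allI)
    show "openin (Euclidean_space (Suc m)) D1"
      using g openin_first_coords_preimage unfolding proper_partial_def D1_def by blast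
    have c: "continuous_on D1 (\<lambda>x. g (first_coords m x))"
      by (rule continuous_on_compose2 [OF contg continuous_on_first_coords]) (auto simp: D1_def)
    show "continuous_on D1 g1"
    proof (rule continuous_on_coordinatewise_then_product)
      show "continuous_on D1 (\<lambda>x. g1 x i)" for i
        using continuous_on_product_then_coordinatewise [OF c, of i]
        by (cases "i < m") (auto simp: g1_def intro: continuous_on_coordinate)
    qed
    show "g1 \<in> D1 \<rightarrow> EE (Suc m)"
      by (auto simp: g1_def D1_def in_topspace_Euclidean_space)
    fix R
    let ?C = "{x \<in> D. norm_sq m (g x) \<le> R} \<times> {-(\<bar>R\<bar> + 1)..\<bar>R\<bar> + 1}"
    let ?j = "\<lambda>p i. if i = m then snd p else fst p i"
    have C: "compact ?C"
      by (intro compact_Times cg) auto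
    have "continuous_on ?C (\<lambda>p. g (fst p))"
      by (rule continuous_on_compose2 [OF contg]) (auto intro: continuous_on_fst continuous_on_id)
    then have "continuous_on ?C (\<lambda>p. norm_sq m (g (fst p)) + (snd p)\<^sup>2)"
      by (intro continuous_on_add continuous_on_norm_sq continuous_on_power continuous_on_snd continuous_on_id)
    then have "closedin (top_of_set ?C) (?C \<inter> (\<lambda>p. norm_sq m (g (fst p)) + (snd p)\<^sup>2) -` {..R})"
      by (rule continuous_closedin_preimage) simp
    then have "compact (?C \<inter> (\<lambda>p. norm_sq m (g (fst p)) + (snd p)\<^sup>2) -` {..R})"
      using C closedin_compact by blast
    moreover have "continuous_on S ?j" for S :: "((nat \<Rightarrow> real) \<times> real) set"
    proof (rule continuous_on_coordinatewise_then_product)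
      have "continuous_on S (\<lambda>p. fst p i)" for i
        by (rule continuous_on_product_then_coordinatewise) (intro continuous_on_fst continuous_on_id)
      then show "continuous_on S (\<lambda>p. ?j p i)" for i
        by (cases "i = m") (auto intro: continuous_on_snd continuous_on_id)
    qed
    ultimately have "compact (?j ` (?C \<inter> (\<lambda>p. norm_sq m (g (fst p)) + (snd p)\<^sup>2) -` {..R}))"
      by (intro compact_continuous_image)
    also have "?j ` (?C \<inter> (\<lambda>p. norm_sq m (g (fst p)) + (snd p)\<^sup>2) -` {..R}) = {x \<in> D1. norm_sq (Suc m) (g1 x) \<le> R}"
    proof (intro subset_antisym subsetI)
      fix x assume "x \<in> ?j ` (?C \<inter> (\<lambda>p. norm_sq m (g (fst p)) + (snd p)\<^sup>2) -` {..R})"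
      then obtain y s where ys: "y \<in> D" "norm_sq m (g y) + s\<^sup>2 \<le> R" "x = ?j (y, s)" by auto
      have "first_coords m x = y"
        using ys DE by (auto simp: first_coords_def in_topspace_Euclidean_space subset_iff fun_eq_iff)
      then show "x \<in> {x \<in> D1. norm_sq (Suc m) (g1 x) \<le> R}"
        using ys DE unfolding norm by (auto simp: D1_def in_topspace_Euclidean_space subset_iff)
    next
      fix x assume x: "x \<in> {x \<in> D1. norm_sq (Suc m) (g1 x) \<le> R}"
      then have le: "norm_sq m (g (first_coords m x)) + (x m)\<^sup>2 \<le> R" by (simp add: norm)
      then have "(x m)\<^sup>2 \<le> \<bar>R\<bar> + 1" using norm_sq_nonneg [of m "g (first_coords m x)"] by linarith
      also have "\<dots> \<le> (\<bar>R\<bar> + 1)\<^sup>2" by (rule self_le_power) auto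
      finally have "\<bar>x m\<bar> \<le> \<bar>R\<bar> + 1" by (intro abs_le_square_iff [THEN iffD2, of "x m" "\<bar>R\<bar> + 1", simplified]) auto
      moreover have "x = ?j (first_coords m x, x m)"
        using x by (auto simp: D1_def first_coords_def in_topspace_Euclidean_space fun_eq_iff)
      moreover have "norm_sq m (g (first_coords m x)) \<le> R" using le zero_le_power2 [of "x m"] by linarith
      ultimately show "x \<in> ?j ` (?C \<inter> (\<lambda>p. norm_sq m (g (fst p)) + (snd p)\<^sup>2) -` {..R})"
        using x le by (intro image_eqI [of _ _ "(first_coords m x, x m)"]) (auto simp: D1_def abs_le_iff)
    qed
    finally show "compact {x \<in> D1. norm_sq (Suc m) (g1 x) \<le> R}" .
  qed
qed

text \<open>Exchanging the new coordinate \<open>m\<close> with the height coordinate \<open>Suc m\<close> turns the suspended map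
  into one that preserves both hemispheres and restricts to the original map on the equator.\<close>

lemma Brouwer_degree2_suspension:
  assumes g: "proper_partial m D g"
  defines "D1 \<equiv> {x \<in> EE (Suc m). first_coords m x \<in> D}"
    and "g1 \<equiv> \<lambda>x i. if i < m then g (first_coords m x) i else x i"
  shows "Brouwer_degree2 (Suc m) (sphere_lift (Suc m) D1 g1) = Brouwer_degree2 m (sphere_lift m D g)"
proof -
  have DE: "D \<subseteq> EE m" and gD: "g \<in> D \<rightarrow> EE m"
    using g openin_subset unfolding proper_partial_def by blast+
  let ?G = "sphere_lift (Suc m) D1 g1"
  let ?p = "Transposition.transpose m (Suc m)"
  have p: "?p permutes {..Suc m}"
    by (rule permutes_swap_id) auto
  have pp: "?p \<circ> ?p = id" by simp
  have G: "continuous_map (nsphere (Suc m)) (nsphere (Suc m)) ?G"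
    unfolding D1_def g1_def by (intro continuous_map_sphere_lift proper_partial_suspension g)
  let ?f = "\<lambda>y. ?G (y \<circ> ?p) \<circ> ?p"
  have swap_in: "y \<circ> ?p \<in> SS (Suc m)" if "y \<in> SS (Suc m)" for y
    using continuous_map_nsphere_permute [OF p] that by (auto simp: continuous_map_nsphere_iff)
  \<comment> \<open>The suspended map leaves coordinate \<open>m\<close> alone, and both
    stereographic maps scale it by a positive factor. So its sign survives, or it becomes 0 at
    infinity; after the exchange this is preservation of hemispheres.\<close>
  have coord: "?G z m = 0 \<or> (\<exists>c>0. ?G z m = c * z m)" if z: "z \<in> SS (Suc m)" for z
  proof (cases "z \<noteq> north_pole (Suc m) \<and> stereo (Suc m) z \<in> D1")
    case True
    have "z (Suc m) < 1"
      using True z north_pole_iff [OF z] nsphere_coordinate_le_1 [OF z, of "Suc m"] by force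
    moreover have "?G z m = 2 * g1 (stereo (Suc m) z) m / (norm_sq (Suc m) (g1 (stereo (Suc m) z)) + 1)"
      using True by (simp add: sphere_lift_def inv_stereo_alt)
    moreover have "g1 (stereo (Suc m) z) m = z m / (1 - z (Suc m))"
      by (simp add: g1_def stereo_def)
    ultimately show ?thesis
      by (intro disjI2 exI [of _ "2 / (norm_sq (Suc m) (g1 (stereo (Suc m) z)) + 1) * (1 / (1 - z (Suc m)))"]) simp
  qed (auto simp: sphere_lift_def north_pole_def)
  have "Brouwer_degree2 (Suc m) ?G = Brouwer_degree2 (Suc m) ?f"
    by (rule Brouwer_degree2_involution_conj(2) [OF p pp G, symmetric])
  also have "\<dots> = Brouwer_degree2 m ?f"
  proof (rule Brouwer_degree2_equator)
    show "continuous_map (nsphere (Suc m)) (nsphere (Suc m)) ?f"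
      by (rule Brouwer_degree2_involution_conj(1) [OF p pp G])
    fix y assume y: "y \<in> SS (Suc m)"
    show "0 \<le> ?f y (Suc m)" if "0 \<le> y (Suc m)"
      using coord [OF swap_in [OF y]] that by auto
    show "?f y (Suc m) \<le> 0" if "y (Suc m) \<le> 0"
      using coord [OF swap_in [OF y]] that by (auto simp: mult_nonneg_nonpos)
  qed
  \<comment> \<open>A point of the equator has coordinate \<open>Suc m\<close> equal to 0. After the
    exchange this is coordinate \<open>m\<close>, so the stereographic image lies in
    \<open>EE m\<close>, where the suspended map is \<open>g\<close>.\<close>
  also have "\<dots> = Brouwer_degree2 m (sphere_lift m D g)"
  proof (rule Brouwer_degree2_eq)
    fix y assume y: "y \<in> SS m"
    have ySuc: "y i = 0" if "i > m" for i
      using y that by (simp add: topspace_nsphere_iff)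
    have N: "y \<circ> ?p = north_pole (Suc m) \<longleftrightarrow> y = north_pole m"
    proof
      assume "y = north_pole m"
      then show "y \<circ> ?p = north_pole (Suc m)"
        by (auto simp: north_pole_def Transposition.transpose_def fun_eq_iff)
    next
      assume "y \<circ> ?p = north_pole (Suc m)"
      then have "(y \<circ> ?p) (Suc m) = 1" by (simp add: north_pole_def)
      then show "y = north_pole m" using y by (simp add: north_pole_iff)
    qed
    have st: "stereo (Suc m) (y \<circ> ?p) = stereo m y"
      by (auto simp: stereo_def Transposition.transpose_def fun_eq_iff less_Suc_eq ySuc)
    have dom: "stereo m y \<in> D1 \<longleftrightarrow> stereo m y \<in> D"
      by (auto simp: D1_def in_topspace_Euclidean_space stereo_def)
    have inv: "inv_stereo (Suc m) x \<circ> ?p = inv_stereo m x" if "x \<in> EE m" for x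
      using that by (auto simp: inv_stereo_alt norm_sq_def in_topspace_Euclidean_space fun_eq_iff
          Transposition.transpose_def)
    have g1: "g1 x = g x" if "x \<in> D" for x
    proof -
      have "x \<in> EE m" "g x \<in> EE m" using that DE gD by auto
      then show ?thesis
        by (auto simp: g1_def fun_eq_iff in_topspace_Euclidean_space)
    qed
    have NP: "north_pole (Suc m) \<circ> ?p = north_pole m"
      by (auto simp: north_pole_def Transposition.transpose_def fun_eq_iff)
    show "?f y = sphere_lift m D g y"
      using gD inv g1 by (auto simp: sphere_lift_def N st dom NP Pi_iff)
  qed
  finally show ?thesis .
qed

definition first_block :: "nat \<Rightarrow> ((nat \<Rightarrow> real) \<Rightarrow> (nat \<Rightarrow> real)) \<Rightarrow> (nat \<Rightarrow> real) \<Rightarrow> (nat \<Rightarrow> real)" where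
  "first_block d g x = (\<lambda>i. if i < d then g (first_coords d x) i else x i)"

lemma first_block_degree:
  assumes g: "proper_partial d D g" and "d \<le> m"
  shows "proper_partial m {x \<in> EE m. first_coords d x \<in> D} (first_block d g)"
    and "Brouwer_degree2 m (sphere_lift m {x \<in> EE m. first_coords d x \<in> D} (first_block d g))
      = Brouwer_degree2 d (sphere_lift d D g)"
proof -
  have "proper_partial m {x \<in> EE m. first_coords d x \<in> D} (first_block d g) \<and>
    Brouwer_degree2 m (sphere_lift m {x \<in> EE m. first_coords d x \<in> D} (first_block d g))
      = Brouwer_degree2 d (sphere_lift d D g)"
    using \<open>d \<le> m\<close>
  proof (induction m rule: dec_induct)
    case base
    have DE: "D \<subseteq> EE d" and gD: "g \<in> D \<rightarrow> EE d"
      using g openin_subset unfolding proper_partial_def by blast+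
    have D: "{x \<in> EE d. first_coords d x \<in> D} = D" using DE by auto
    have eq: "first_block d g x = g x" if "x \<in> D" for x
    proof -
      have "x \<in> EE d" "g x \<in> EE d" using that DE gD by auto
      then show ?thesis
        by (auto simp: first_block_def fun_eq_iff in_topspace_Euclidean_space)
    qed
    then have "sphere_lift d D (first_block d g) = sphere_lift d D g"
      by (intro ext sphere_lift_cong) auto
    moreover have "proper_partial d D (first_block d g)"
      using g eq unfolding proper_partial_def
      by (auto cong: continuous_on_cong conj_cong)
    ultimately show ?case using D by simp
  next
    case (step m)
    let ?D = "{x \<in> EE m. first_coords d x \<in> D}" and ?g = "first_block d g"
    have dom: "{x \<in> EE (Suc m). first_coords m x \<in> ?D} = {x \<in> EE (Suc m). first_coords d x \<in> D}"
      using step by auto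
    have map: "(\<lambda>x i. if i < m then ?g (first_coords m x) i else x i) = first_block d g"
      using step by (auto simp: first_block_def fun_eq_iff) (auto simp: first_coords_def)
    show ?case
      using step proper_partial_suspension [of m ?D ?g] Brouwer_degree2_suspension [of m ?D ?g]
      unfolding dom map by simp
  qed
  then show "proper_partial m {x \<in> EE m. first_coords d x \<in> D} (first_block d g)"
    and "Brouwer_degree2 m (sphere_lift m {x \<in> EE m. first_coords d x \<in> D} (first_block d g))
      = Brouwer_degree2 d (sphere_lift d D g)" by auto
qed

section \<open>Products of block maps\<close>

lemma permutes_lessThan_atMost: "(p :: nat \<Rightarrow> nat) permutes {..<m} \<Longrightarrow> p permutes {..m}"
  by (rule permutes_subset) auto

lemma north_pole_permute:
  assumes p: "p permutes {..<m}"
  shows "north_pole m \<circ> p = north_pole m"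
proof -
  have "p i = m \<longleftrightarrow> i = m" for i
    using permutes_inj [OF p] permutes_not_in [OF p, of m] by (metis injD lessThan_iff less_irrefl)
  then show ?thesis
    by (simp add: north_pole_def fun_eq_iff)
qed

text \<open>A permutation of \<open>{..<m}\<close> fixes the height index \<open>m\<close> and
  preserves \<open>norm_sq\<close>, the only other ingredient of the chart.\<close>

lemma inv_stereo_permute:
  assumes p: "p permutes {..<m}"
  shows "inv_stereo m (x \<circ> p) = inv_stereo m x \<circ> p"
proof -
  have "p i < m \<longleftrightarrow> i < m" for i
    using permutes_in_image [OF p, of i] by simp
  moreover have "p i = i" if "\<not> i < m" for i
    using permutes_not_in [OF p] that by simp
  moreover have "norm_sq m (x \<circ> p) = norm_sq m x"
    using sum.permute [OF p, of "\<lambda>i. (x i)\<^sup>2"] by (simp add: o_def norm_sq_def)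
  ultimately show ?thesis
    by (fastforce simp: inv_stereo_alt fun_eq_iff)
qed

lemma permute_in_Euclidean_space:
  assumes p: "p permutes {..<m}"
  shows "x \<circ> p \<in> EE m \<longleftrightarrow> x \<in> EE m"
proof -
  have "p i = i" if "i \<ge> m" for i
    using permutes_not_in [OF p] that by simp
  then show ?thesis
    by (auto simp: in_topspace_Euclidean_space)
qed

lemma nsphere_cases:
  assumes "y \<in> SS m"
  obtains "y = north_pole m" | x where "x \<in> EE m" "y = inv_stereo m x"
  using assms inv_stereo_stereo stereo_in_Euclidean_space by metis

text \<open>Blocks are counted from 0 while the factors of the product are counted from 1, hence the
  shift \<open>i - 1\<close> in \<open>product_chart\<close>. Padding by 0 places the result in
  \<open>EE d\<close>.\<close>

definition block :: "nat \<Rightarrow> nat \<Rightarrow> (nat \<Rightarrow> real) \<Rightarrow> (nat \<Rightarrow> real)" where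
  "block d i x = (\<lambda>j. if j < d then x (i * d + j) else 0)"

definition on_block ::
    "nat \<Rightarrow> nat \<Rightarrow> ((nat \<Rightarrow> real) \<Rightarrow> (nat \<Rightarrow> real)) \<Rightarrow> (nat \<Rightarrow> real) \<Rightarrow> (nat \<Rightarrow> real)" where
  "on_block d i g x = (\<lambda>l. if i * d \<le> l \<and> l < i * d + d then g (block d i x) (l - i * d) else x l)"

lemma block_in_Euclidean_space [simp]: "block d i x \<in> EE d"
  by (simp add: block_def in_topspace_Euclidean_space)

lemma block_0: "block d 0 x = first_coords d x"
  by (auto simp: block_def first_coords_def fun_eq_iff)

lemma continuous_on_block: "continuous_on S (block d i)"
proof (rule continuous_on_coordinatewise_then_product)
  show "continuous_on S (\<lambda>x. block d i x j)" for j
    by (cases "j < d") (auto simp: block_def intro: continuous_on_coordinate)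
qed

lemma openin_block_preimage:
  assumes "openin (Euclidean_space d) D"
  shows "openin (Euclidean_space m) {x \<in> EE m. block d i x \<in> D}"
  using continuous_openin_preimage [OF continuous_on_block, of d i "EE m" "EE d" D] assms
  by (simp add: openin_Euclidean_space_iff Int_def)

lemma mult_add_le:
  fixes i n d :: nat
  assumes "i < n" shows "i * d + d \<le> n * d"
  using mult_le_mono1 [of "Suc i" n d] assms by simp

text \<open>Exchanging block \<open>i\<close> with block 0 is chosen over a cyclic move because it
  is an involution, so conjugation by it preserves degrees.\<close>

definition swap_block :: "nat \<Rightarrow> nat \<Rightarrow> nat \<Rightarrow> nat" where
  "swap_block d i l =
    (if l < d then i * d + l else if i * d \<le> l \<and> l < i * d + d then l - i * d else l)"

lemma swap_block_swap_block [simp]: "swap_block d i (swap_block d i l) = l"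
\<comment> \<open>For positive \<open>i\<close> the two blocks are disjoint, as \<open>i * d\<close>
  is at least \<open>d\<close>; for \<open>i = 0\<close> the map is the identity.\<close>
proof (cases i)
  case (Suc k)
  then show ?thesis by (auto simp: swap_block_def)
qed (auto simp: swap_block_def)

lemma swap_block_permutes:
  assumes "i < n" shows "swap_block d i permutes {..<n * d}"
proof (rule bij_imp_permutes)
  have "swap_block d i l < n * d" if "l < n * d" for l
    using that mult_add_le [OF assms, of d] by (auto simp: swap_block_def)
  then show "bij_betw (swap_block d i) {..<n * d} {..<n * d}"
    by (intro bij_betwI [where g = "swap_block d i"]) auto
  show "swap_block d i l = l" if "l \<notin> {..<n * d}" for l
    using that mult_add_le [OF assms, of d] by (auto simp: swap_block_def)
qed

text \<open>Conjugating by the block exchange reduces this to block 0. The conjugate of a lift is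
  again a lift, because permutations of the indices below \<open>m\<close> commute with the chart
  and fix infinity.\<close>

lemma on_block_degree:
  assumes g: "proper_partial d D g" and i: "i < n"
  defines "m \<equiv> n * d"
  defines "D' \<equiv> {x \<in> EE m. block d i x \<in> D}"
  shows "continuous_map (nsphere m) (nsphere m) (sphere_lift m D' (on_block d i g))"
    and "Brouwer_degree2 m (sphere_lift m D' (on_block d i g)) = Brouwer_degree2 d (sphere_lift d D g)"
proof -
  let ?p = "swap_block d i"
  have p: "?p permutes {..<m}" and pp: "?p \<circ> ?p = id"
    using swap_block_permutes [OF i] by (auto simp: m_def)
  have "d \<le> m"
    using mult_add_le [OF i, of d] unfolding m_def by linarith
  let ?F = "sphere_lift m {x \<in> EE m. first_coords d x \<in> D} (first_block d g)"
  have F: "continuous_map (nsphere m) (nsphere m) ?F"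
    "Brouwer_degree2 m ?F = Brouwer_degree2 d (sphere_lift d D g)"
    using first_block_degree [OF g \<open>d \<le> m\<close>] continuous_map_sphere_lift by auto
  have fc: "first_coords d (x \<circ> ?p) = block d i x" for x
    by (auto simp: first_coords_def block_def swap_block_def fun_eq_iff)
  have fb: "first_block d g (x \<circ> ?p) \<circ> ?p = on_block d i g x" for x
  proof
    fix l
    have "(first_block d g (x \<circ> ?p) \<circ> ?p) l = (if ?p l < d then g (block d i x) (?p l) else x l)"
      by (simp add: first_block_def fc)
    also have "\<dots> = on_block d i g x l"
    proof (cases i)
      case (Suc k)
      then show ?thesis by (auto simp: swap_block_def on_block_def)
    qed (auto simp: swap_block_def on_block_def)
    finally show "(first_block d g (x \<circ> ?p) \<circ> ?p) l = on_block d i g x l" .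
  qed
  have eq: "?F (y \<circ> ?p) \<circ> ?p = sphere_lift m D' (on_block d i g) y" if y: "y \<in> SS m" for y
    using y
  proof (cases rule: nsphere_cases)
    case 1
    then show ?thesis
      by (simp add: north_pole_permute [OF p])
  next
    case (2 x)
    have "x \<circ> ?p \<in> EE m"
      using 2 permute_in_Euclidean_space [OF p] by simp
    then have "?F (y \<circ> ?p) \<circ> ?p = (if block d i x \<in> D then inv_stereo m (first_block d g (x \<circ> ?p)) \<circ> ?p
        else north_pole m)"
      by (simp add: 2 fc north_pole_permute [OF p] flip: inv_stereo_permute [OF p])
    also have "\<dots> = sphere_lift m D' (on_block d i g) y"
      using 2 by (simp add: D'_def fb flip: inv_stereo_permute [OF p])
    finally show ?thesis .
  qed
  have pa: "?p permutes {..m}" by (rule permutes_lessThan_atMost [OF p])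
  show "continuous_map (nsphere m) (nsphere m) (sphere_lift m D' (on_block d i g))"
    by (rule continuous_map_eq [OF Brouwer_degree2_involution_conj(1) [OF pa pp F(1)] eq])
  show "Brouwer_degree2 m (sphere_lift m D' (on_block d i g)) = Brouwer_degree2 d (sphere_lift d D g)"
    using Brouwer_degree2_involution_conj(2) [OF pa pp F(1)] F(2) Brouwer_degree2_eq [OF eq] by simp
qed

definition on_blocks ::
    "nat \<Rightarrow> nat \<Rightarrow> (nat \<Rightarrow> (nat \<Rightarrow> real) \<Rightarrow> (nat \<Rightarrow> real)) \<Rightarrow> (nat \<Rightarrow> real) \<Rightarrow> (nat \<Rightarrow> real)" where
  "on_blocks d k g x = (\<lambda>l. if l < k * d then g (l div d) (block d (l div d) x) (l mod d) else x l)"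

lemma on_blocks_in_Euclidean_space:
  "k \<le> n \<Longrightarrow> x \<in> EE (n * d) \<Longrightarrow> on_blocks d k g x \<in> EE (n * d)"
  unfolding on_blocks_def in_topspace_Euclidean_space
  by (meson mult_le_mono1 leD le_trans)

lemma block_on_blocks:
  assumes "g i (block d i x) \<in> EE d" "i < k"
  shows "block d i (on_blocks d k g x) = g i (block d i x)"
proof
  fix j
  show "block d i (on_blocks d k g x) j = g i (block d i x) j"
  proof (cases "j < d")
    case True
    then have "i * d + j < k * d"
      using mult_add_le [OF assms(2), of d] by simp
    then have "on_blocks d k g x (i * d + j) = g i (block d i x) j"
      using True by (simp add: on_blocks_def)
    then show ?thesis
      using True unfolding block_def [of d i "on_blocks d k g x"] by simp
  qed (use assms in \<open>auto simp: block_def in_topspace_Euclidean_space\<close>)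
qed

text \<open>The induction counts the blocks already treated; each step composes with a lift acting
  on the next block, and degrees multiply. For \<open>k = 0\<close> the partial map is the identity
  on all of \<open>EE m\<close>, which lifts to the identity of the sphere.\<close>

lemma on_blocks_degree:
  assumes g: "\<And>i. i < n \<Longrightarrow> proper_partial d (D i) (g i)" and "k \<le> n"
  defines "m \<equiv> n * d"
  defines "D' \<equiv> \<lambda>k. {x \<in> EE m. \<forall>i<k. block d i x \<in> D i}"
  shows "continuous_map (nsphere m) (nsphere m) (sphere_lift m (D' k) (on_blocks d k g))"
    and "Brouwer_degree2 m (sphere_lift m (D' k) (on_blocks d k g))
      = (\<Prod>i<k. Brouwer_degree2 d (sphere_lift d (D i) (g i)))"
proof -
  let ?P = "\<lambda>k. sphere_lift m (D' k) (on_blocks d k g)"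
  have "continuous_map (nsphere m) (nsphere m) (?P k) \<and>
    Brouwer_degree2 m (?P k) = (\<Prod>i<k. Brouwer_degree2 d (sphere_lift d (D i) (g i)))"
    using \<open>k \<le> n\<close>
  proof (induction k)
    case 0
    have eq: "?P 0 y = id y" if "y \<in> SS m" for y
      using that by (cases rule: nsphere_cases) (auto simp: D'_def on_blocks_def)
    then show ?case
      using continuous_map_eq [of "nsphere m" "nsphere m" id "?P 0"] Brouwer_degree2_eq [of m "?P 0" id]
      by simp
  next
    case (Suc k)
    let ?B = "sphere_lift m {x \<in> EE m. block d k x \<in> D k} (on_block d k (g k))"
    have B: "continuous_map (nsphere m) (nsphere m) ?B"
      "Brouwer_degree2 m ?B = Brouwer_degree2 d (sphere_lift d (D k) (g k))"
      using on_block_degree [OF g, of k k] Suc.prems unfolding m_def by auto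
    have in_E: "on_blocks d k g x \<in> EE m" if "x \<in> EE m" for x
      using that on_blocks_in_Euclidean_space [of k n x d g] Suc.prems by (simp add: m_def)
    \<comment> \<open>Earlier stages leave block \<open>k\<close> untouched, so the natural domain
      of the composite is exactly \<open>D' (Suc k)\<close>.\<close>
    have blk: "block d k (on_blocks d k g x) = block d k x" for x
      by (auto simp: block_def on_blocks_def)
    have dom: "{x \<in> D' k. on_blocks d k g x \<in> {x \<in> EE m. block d k x \<in> D k}} = D' (Suc k)"
      by (auto simp: D'_def blk in_E less_Suc_eq)
    have map: "(on_block d k (g k) \<circ> on_blocks d k g) x = on_blocks d (Suc k) g x" for x
    proof
      fix l
      consider "l < k * d" | "k * d \<le> l \<and> l < k * d + d" | "k * d + d \<le> l" by linarith
      then show "(on_block d k (g k) \<circ> on_blocks d k g) x l = on_blocks d (Suc k) g x l"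
      proof cases
        case 2
        then have "l div d = k" "l mod d = l - k * d"
          by (auto simp: div_nat_eqI mult.commute modulo_nat_def)
        then show ?thesis
          using 2 by (simp add: on_block_def blk) (simp add: on_blocks_def add.commute)
      qed (auto simp: on_block_def on_blocks_def)
    qed
    have eq: "(?B \<circ> ?P k) y = ?P (Suc k) y" if "y \<in> SS m" for y
    proof -
      have "?B (?P k y) = sphere_lift m {x \<in> D' k. on_blocks d k g x \<in> {x \<in> EE m. block d k x \<in> D k}}
          (on_block d k (g k) \<circ> on_blocks d k g) y"
        by (rule sphere_lift_compose) (use that in_E in \<open>auto simp: D'_def\<close>)
      moreover have "on_block d k (g k) \<circ> on_blocks d k g = on_blocks d (Suc k) g"
        by (rule ext) (rule map)
      ultimately show ?thesis
        unfolding dom by simp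
    qed
    have P: "continuous_map (nsphere m) (nsphere m) (?P k)"
      and dP: "Brouwer_degree2 m (?P k) = (\<Prod>i<k. Brouwer_degree2 d (sphere_lift d (D i) (g i)))"
      using Suc by auto
    have "continuous_map (nsphere m) (nsphere m) (?P (Suc k))"
      by (rule continuous_map_eq [OF continuous_map_compose [OF P B(1)] eq])
    moreover have "Brouwer_degree2 m (?B \<circ> ?P k) = Brouwer_degree2 m (?P (Suc k))"
      by (rule Brouwer_degree2_eq) (rule eq)
    then have "Brouwer_degree2 m (?P (Suc k)) = Brouwer_degree2 m ?B * Brouwer_degree2 m (?P k)"
      using Brouwer_degree2_compose [OF P B(1)] by simp
    ultimately show ?case
      using B(2) dP by simp
  qed
  then show "continuous_map (nsphere m) (nsphere m) (?P k)"
    "Brouwer_degree2 m (?P k) = (\<Prod>i<k. Brouwer_degree2 d (sphere_lift d (D i) (g i)))" by auto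
qed

section \<open>The degree of a rotation of coordinates\<close>

definition cyclic_shift :: "nat \<Rightarrow> nat \<Rightarrow> nat" where
  "cyclic_shift m l = (if Suc l < m then Suc l else if Suc l = m then 0 else l)"

lemma cyclic_shift_Suc:
  assumes "0 < m"
  shows "cyclic_shift (Suc m) = cyclic_shift m \<circ> Transposition.transpose (m - 1) m"
  using assms by (auto simp: cyclic_shift_def Transposition.transpose_def fun_eq_iff)

text \<open>The sphere dimension \<open>M\<close> stays fixed while the cycle grows, so each
  induction step contributes one transposition of degree -1. Truncated subtraction gives exponent 0
  for both \<open>m = 0\<close> and \<open>m = 1\<close>, where the shift is the identity.\<close>

lemma cyclic_shift_degree:
  assumes "m \<le> M"
  shows "cyclic_shift m permutes {..<m} \<and>
    Brouwer_degree2 M (\<lambda>y. y \<circ> cyclic_shift m) = (- 1) ^ (m - 1)"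
  using assms
proof (induction m)
  case 0
  have "cyclic_shift 0 = id" by (auto simp: cyclic_shift_def)
  then show ?case
    using Brouwer_degree2_id [of M] by (simp add: permutes_id [unfolded id_def] id_def o_def)
next
  case (Suc m)
  show ?case
  proof (cases "m = 0")
    case True
    have "cyclic_shift 1 = id" by (auto simp: cyclic_shift_def)
    then show ?thesis
      using Brouwer_degree2_id [of M] True by (simp add: permutes_id [unfolded id_def] id_def o_def)
  next
    case False
    let ?t = "Transposition.transpose (m - 1) m"
    have t: "?t permutes {..<Suc m}" "?t permutes {..M}"
      using Suc.prems by (auto intro!: permutes_swap_id)
    have s: "cyclic_shift m permutes {..<Suc m}" "cyclic_shift m permutes {..M}"
      using Suc by (auto intro: permutes_subset [of _ "{..<m}"])
    have "Brouwer_degree2 M (\<lambda>y. y \<circ> cyclic_shift (Suc m))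
        = Brouwer_degree2 M (\<lambda>y. y \<circ> cyclic_shift m) * Brouwer_degree2 M (\<lambda>y. y \<circ> ?t)"
      using False by (simp only: cyclic_shift_Suc Brouwer_degree2_permute_compose [OF s(2) t(2)])
    also have "\<dots> = (- 1) ^ (m - 1) * (- 1)"
    proof -
      have "Brouwer_degree2 M (\<lambda>y. y \<circ> cyclic_shift m) = (- 1) ^ (m - 1)"
        using Suc by (meson Suc_leD)
      moreover have "Brouwer_degree2 M (\<lambda>y. y \<circ> ?t) = - 1"
        using Suc.prems False by (intro Brouwer_degree2_transpose) auto
      ultimately show ?thesis by simp
    qed
    also have "\<dots> = (- 1) ^ (Suc m - 1)"
      using False by (cases m) auto
    finally have "Brouwer_degree2 M (\<lambda>y. y \<circ> cyclic_shift (Suc m)) = (- 1) ^ (Suc m - 1)" .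
    moreover have "cyclic_shift (Suc m) permutes {..<Suc m}"
      unfolding cyclic_shift_Suc [OF False [simplified]] by (rule permutes_compose [OF t(1) s(1)])
    ultimately show ?thesis by (rule conjI [rotated])
  qed
qed

text \<open>A rotation by \<open>k\<close> places is the \<open>k\<close>-th power of the full
  cycle, which gives its sign; the explicit formula modulo \<open>m\<close> serves to match blocks
  later.\<close>

lemma rotation_degree:
  "(cyclic_shift m ^^ k) permutes {..<m} \<and>
    Brouwer_degree2 m (\<lambda>y. y \<circ> (cyclic_shift m ^^ k)) = (- 1) ^ ((m - 1) * k) \<and>
    (\<forall>l<m. (cyclic_shift m ^^ k) l = (l + k) mod m)"
proof (induction k)
  case 0
  then show ?case
    using Brouwer_degree2_id [of m] by (simp add: permutes_id [unfolded id_def] id_def)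
next
  case (Suc k)
  have s: "cyclic_shift m permutes {..<m}"
    and ds: "Brouwer_degree2 m (\<lambda>y. y \<circ> cyclic_shift m) = (- 1) ^ (m - 1)"
    using cyclic_shift_degree [of m m] by auto
  have k: "(cyclic_shift m ^^ k) permutes {..<m}"
    and dk: "Brouwer_degree2 m (\<lambda>y. y \<circ> (cyclic_shift m ^^ k)) = (- 1) ^ ((m - 1) * k)"
    and ek: "\<forall>l<m. (cyclic_shift m ^^ k) l = (l + k) mod m"
    using Suc by blast+
  have eq: "cyclic_shift m ^^ Suc k = cyclic_shift m \<circ> (cyclic_shift m ^^ k)"
    by simp
  have "Brouwer_degree2 m (\<lambda>y. y \<circ> (cyclic_shift m ^^ Suc k)) = (- 1) ^ (m - 1) * (- 1) ^ ((m - 1) * k)"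
    unfolding eq Brouwer_degree2_permute_compose [OF permutes_lessThan_atMost [OF s] permutes_lessThan_atMost [OF k]]
      ds dk by (rule refl)
  also have "\<dots> = (- 1) ^ ((m - 1) * Suc k)"
    by (simp add: power_add)
  finally have "Brouwer_degree2 m (\<lambda>y. y \<circ> (cyclic_shift m ^^ Suc k)) = (- 1) ^ ((m - 1) * Suc k)" .
  moreover have "(cyclic_shift m ^^ Suc k) l = (l + Suc k) mod m" if "l < m" for l
  proof -
    have "(l + k) mod m < m" using that by simp
    then have "Suc ((l + k) mod m) < m \<or> Suc ((l + k) mod m) = m" by linarith
    then show ?thesis
      using that ek by (auto simp: cyclic_shift_def mod_Suc)
  qed
  moreover have "(cyclic_shift m ^^ Suc k) permutes {..<m}"
    unfolding eq by (rule permutes_compose [OF k s])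
  ultimately show ?case by blast
qed

section \<open>The coincidence degree in coordinates\<close>

lemma block_div_mod: "l < n * d \<Longrightarrow> block d (l div d) x (l mod d) = x l"
  by (cases "d = 0") (auto simp: block_def)

lemma block_zero: "block d i (\<lambda>i. 0) = (\<lambda>i. 0)"
  by (simp add: block_def)

lemma eq_if_blocks_eq:
  assumes "x \<in> EE (n * d)" "y \<in> EE (n * d)" "\<And>i. i < n \<Longrightarrow> block d i x = block d i y"
  shows "x = y"
proof
  fix l show "x l = y l"
  proof (cases "l < n * d")
    case True
    then show ?thesis
      using assms(3) [of "l div d"] block_div_mod [of l n d]
      by (metis less_mult_imp_div_less)
  qed (use assms in \<open>auto simp: in_topspace_Euclidean_space\<close>)
qed

lemma in_first_block:
  assumes x: "x \<in> EE (n * d)" "1 \<le> n" and z: "\<And>i. 1 \<le> i \<Longrightarrow> i < n \<Longrightarrow> block d i x = (\<lambda>i. 0)"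
  shows "x \<in> EE d"
  unfolding in_topspace_Euclidean_space
proof (intro allI impI)
  fix l assume l: "d \<le> l"
  show "x l = 0"
  proof (cases "l < n * d")
    case True
    then have "0 < d" by (cases d) auto
    then have "1 \<le> l div d" using l by (simp add: Suc_le_eq div_greater_zero_iff)
    then have "block d (l div d) x = (\<lambda>i. 0)"
      using z True less_mult_imp_div_less by blast
    then show ?thesis using block_div_mod [OF True, of x] by simp
  qed (use x in \<open>auto simp: in_topspace_Euclidean_space\<close>)
qed

text \<open>Excision: openness and continuity are asked on \<open>N\<close> only, and the degree
  over \<open>V\<close> is computed there because both sets contain the same zeros. The cutoff
  construction is applied to a homotopy constant in \<open>t\<close>.\<close>

lemma local_proper_extension:
  assumes N: "openin (Euclidean_space d) N" and e: "continuous_on N e" "e \<in> N \<rightarrow> EE d"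
    and Z: "compact Z" "{w \<in> N. e w = (\<lambda>i. 0)} = Z"
    and V: "N \<subseteq> V" "{w \<in> V. e w = (\<lambda>i. 0)} = Z"
  shows "\<exists>D g W. proper_partial d D g \<and> openin (Euclidean_space d) W \<and> Z \<subseteq> W \<and> W \<subseteq> D \<and>
    (\<forall>x\<in>W. g x = e x) \<and> (\<forall>x\<in>D. g x = (\<lambda>i. 0) \<longrightarrow> x \<in> Z) \<and>
    brouwer_degree d e V (\<lambda>i. 0) = Brouwer_degree2 d (sphere_lift d D g)"
proof -
  have "continuous_on ({0..1::real} \<times> N) (\<lambda>(t, x). e x)"
    unfolding case_prod_unfold
    by (rule continuous_on_compose2 [OF e(1)]) (auto intro: continuous_on_snd continuous_on_id)
  then obtain D g W where
    g: "\<forall>t\<in>{0..1::real}. proper_partial d D (g t)" and W: "openin (Euclidean_space d) W" "Z \<subseteq> W" "W \<subseteq> D" "D \<subseteq> N"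
    and eq: "\<forall>t. \<forall>x\<in>W. g t x = e x" and zero: "\<forall>t\<in>{0..1::real}. \<forall>x\<in>D. g t x = (\<lambda>i. 0) \<longrightarrow> x \<in> Z"
    by (rule proper_partial_homotopy [OF N _ _ Z(1), where f = "\<lambda>t. e"]) (use e Z in auto)
  have g0: "proper_partial d D (g 0)" using g by simp
  have "brouwer_degree d e V (\<lambda>i. 0) = Brouwer_degree2 d (sphere_lift d D (g 0))"
  proof (rule brouwer_degree_sphere_lift [OF continuous_map_sphere_lift [OF g0], where W = W])
    show "compact {x \<in> V. e x = (\<lambda>i. 0)}" using V Z by simp
    show "D \<subseteq> EE d" "g 0 \<in> D \<rightarrow> EE d"
      using g0 openin_subset unfolding proper_partial_def by blast+
    show "x \<in> V \<and> e x = (\<lambda>i. 0)" if "x \<in> D" "g 0 x = (\<lambda>i. 0)" for x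
    proof -
      have "x \<in> Z" using zero that by auto
      then show ?thesis using V by blast
    qed
  qed (use W eq V in auto)
  then show ?thesis
    using g0 W eq zero by (intro exI [of _ D] exI [of _ "g 0"] exI [of _ W]) auto
qed

text \<open>For even \<open>d\<close> both exponents are even. For odd \<open>d\<close> they have
  the parities of \<open>n - 1\<close> and \<open>n + 1\<close>; here \<open>1 \<le> n * d\<close>
  keeps the subtraction from being truncated.\<close>

lemma minus_one_power_rotation:
  assumes "1 \<le> (n::nat)"
  shows "(- 1 :: int) ^ ((n * d - 1) * d) = (- 1) ^ (d * (n + 1))"
proof (cases "even d")
  case False
  then have "1 \<le> n * d" using assms by (cases d) auto
  then show ?thesis
    using False by (simp add: minus_one_power_iff)
qed simp

section \<open>Decoupling the last component\<close>

definition shrink :: "nat \<Rightarrow> real \<Rightarrow> (nat \<Rightarrow> real) \<Rightarrow> (nat \<Rightarrow> real)" where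
  "shrink d t x = (\<lambda>l. if l < d then x l else t * x l)"

lemma continuous_on_shrink: "continuous_on S (\<lambda>p. shrink d (fst p) (snd p))"
proof (rule continuous_on_coordinatewise_then_product)
  have "continuous_on S (\<lambda>p. snd p l)" for l
    by (rule continuous_on_product_then_coordinatewise) (intro continuous_on_snd continuous_on_id)
  then show "continuous_on S (\<lambda>p. shrink d (fst p) (snd p) l)" for l
    by (cases "l < d") (auto simp: shrink_def intro!: continuous_on_mult continuous_on_fst continuous_on_id)
qed

lemma shrink_simps [simp]: "shrink d 1 x = x" "shrink d 0 x = first_coords d x"
  "x \<in> EE d \<Longrightarrow> shrink d t x = x" "x \<in> EE m \<Longrightarrow> shrink d t x \<in> EE m"
  by (auto simp: shrink_def first_coords_def in_topspace_Euclidean_space fun_eq_iff)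

text \<open>The shrinking of the variables after the first decouples the last component; the zeros stay
  put, since all of them lie on the first axis.\<close>

lemma cyclic_product_degree:
  fixes n d :: nat and f :: "(nat \<Rightarrow> real) \<Rightarrow> (nat \<Rightarrow> real)"
    and e :: "nat \<Rightarrow> (nat \<Rightarrow> real) \<Rightarrow> (nat \<Rightarrow> real)" and V :: "nat \<Rightarrow> (nat \<Rightarrow> real) set"
  defines "m \<equiv> n * d"
  assumes n: "1 \<le> n"
    and U: "openin (Euclidean_space m) U" and f: "continuous_on U f" "f \<in> U \<rightarrow> EE m"
    and compact: "compact {x \<in> U. f x = (\<lambda>i. 0)}"
    and blocks: "\<And>x j. x \<in> U \<Longrightarrow> 1 \<le> j \<Longrightarrow> j < n \<Longrightarrow> block d (j - 1) (f x) = e j (block d j x)"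
    and V: "\<And>x j. x \<in> U \<Longrightarrow> 1 \<le> j \<Longrightarrow> j < n \<Longrightarrow> block d j x \<in> V j"
    and eV: "\<And>j. 1 \<le> j \<Longrightarrow> j < n \<Longrightarrow> {w \<in> V j. e j w = (\<lambda>i. 0)} = {\<lambda>i. 0}"
    and last: "\<And>w. w \<in> EE d \<Longrightarrow> w \<in> U \<Longrightarrow> e 0 w = block d (n - 1) (f w)"
  shows "brouwer_degree m f U (\<lambda>i. 0) = (- 1) ^ (d * (n + 1)) * brouwer_degree d (e 0) (EE d \<inter> U) (\<lambda>i. 0) *
    (\<Prod>j=1..<n. brouwer_degree d (e j) (V j) (\<lambda>i. 0))"
proof -
  let ?O = "\<lambda>i::nat. 0::real"
  define Z where "Z = {x \<in> U. f x = ?O}"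
  have UE: "U \<subseteq> EE m" using U openin_subset by blast
  have dm: "d \<le> m" using mult_add_le [of 0 n d] n by (simp add: m_def)
  then have EdE: "EE d \<subseteq> EE m" by (auto simp: in_topspace_Euclidean_space)
  obtain O1 where O1: "open O1" "U = EE m \<inter> O1"
    using U by (auto simp: openin_Euclidean_space_iff openin_open)
  have eq0: "block d j x = ?O" if "x \<in> U" "1 \<le> j" "j < n" "block d (j - 1) (f x) = ?O" for x j
    using blocks [of x j] V [of x j] eV [of j] that by auto
  have e0: "e j ?O = ?O" if "1 \<le> j" "j < n" for j
    using eV [OF that] by blast
  have ZE: "x \<in> EE d" if "x \<in> Z" for x
  proof (rule in_first_block [OF _ n])
    show "x \<in> EE (n * d)" using that UE by (auto simp: Z_def m_def)
    show "block d i x = ?O" if "1 \<le> i" "i < n" for i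
      using eq0 [of x i] that \<open>x \<in> Z\<close> by (auto simp: Z_def block_zero)
  qed
  \<comment> \<open>As sets of functions \<open>EE d\<close> is contained in \<open>EE m\<close>, so
    the zeros of \<open>e 0\<close> and those of \<open>f\<close> can be compared without an
    embedding.\<close>
  have Z_axis: "{w \<in> EE d \<inter> U. e 0 w = ?O} = Z"
  proof (intro subset_antisym subsetI)
    fix w assume w: "w \<in> {w \<in> EE d \<inter> U. e 0 w = ?O}"
    have blk: "block d i (f w) = block d i ?O" if "i < n" for i
    proof (cases "i = n - 1")
      case True
      have "block d (n - 1) (f w) = ?O" using w last [of w] by simp
      then show ?thesis using True by (simp add: block_zero)
    next
      case False
      have "block d (Suc i) w = ?O"
        using w by (auto simp: block_def in_topspace_Euclidean_space fun_eq_iff)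
      then show ?thesis
        using blocks [of w "Suc i"] e0 [of "Suc i"] False that w by (simp add: block_zero)
    qed
    have "f w \<in> EE (n * d)" "?O \<in> EE (n * d)"
      using funcset_mem [OF f(2), of w] w by (simp_all add: m_def in_topspace_Euclidean_space)
    from eq_if_blocks_eq [OF this blk] have "f w = ?O" by blast
    then show "w \<in> Z" using w by (simp add: Z_def)
  next
    fix x assume x: "x \<in> Z"
    then show "x \<in> {w \<in> EE d \<inter> U. e 0 w = ?O}"
      using ZE [OF x] last [of x] by (auto simp: Z_def block_zero)
  qed
  show ?thesis
  proof (cases "Z = {}")
    \<comment> \<open>Without zeros the left side and the factor of \<open>e 0\<close> both vanish.
      Otherwise a zero \<open>z\<close> is available as base point for slices.\<close>
    case True
    then have "brouwer_degree m f U ?O = 0"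
      by (intro brouwer_degree_no_zero) (auto simp: Z_def)
    moreover have "brouwer_degree d (e 0) (EE d \<inter> U) ?O = 0"
      using True Z_axis by (intro brouwer_degree_no_zero) auto
    ultimately show ?thesis by simp
  next
    case False
    then obtain z where z: "z \<in> Z" by blast
    define V' where "V' = (\<lambda>j. if j = 0 then EE d \<inter> U else V j)"
    define Zs where "Zs = (\<lambda>j::nat. if j = 0 then Z else {?O})"
    define Q where "Q = (\<lambda>j D g W. proper_partial d D g \<and> openin (Euclidean_space d) W \<and> Zs j \<subseteq> W \<and> W \<subseteq> D \<and>
      (\<forall>x\<in>W. g x = e j x) \<and> (\<forall>x\<in>D. g x = ?O \<longrightarrow> x \<in> Zs j) \<and>
      brouwer_degree d (e j) (V' j) ?O = Brouwer_degree2 d (sphere_lift d D g))"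
    have ex: "\<exists>D g W. Q j D g W" if j: "j < n" for j
    proof (cases "j = 0")
      case True
      have "EE d \<inter> U = EE d \<inter> O1" unfolding O1(2) using EdE by blast
      then have ope: "openin (Euclidean_space d) (EE d \<inter> U)"
        using O1(1) by (simp add: openin_Euclidean_space_iff openin_open_Int)
      have cont: "continuous_on (EE d \<inter> U) (e 0)"
      proof -
        have "continuous_on (EE d \<inter> U) (\<lambda>w. block d (n - 1) (f w))"
          by (rule continuous_on_compose2 [OF continuous_on_block continuous_on_subset [OF f(1)]]) auto
        then show ?thesis using last by (subst continuous_on_cong [OF refl]) auto
      qed
      have eE: "e 0 \<in> EE d \<inter> U \<rightarrow> EE d" using last by auto
      have V0: "V' 0 = EE d \<inter> U" "Zs 0 = Z" by (auto simp: V'_def Zs_def)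
      have cZ: "compact Z" using compact by (simp add: Z_def)
      show ?thesis
        unfolding True Q_def V0 by (rule local_proper_extension [OF ope cont eE cZ Z_axis order_refl Z_axis])
    next
      case False
      \<comment> \<open>The slice through \<open>z\<close> in the direction of block
        \<open>j\<close>. As \<open>z\<close> lies on the first axis, its block \<open>j\<close> is
        0 and the origin is sent to \<open>z\<close>, inside \<open>U\<close>. On the slice
        \<open>e j\<close> is a block of \<open>f\<close>, which yields its continuity near
        0.\<close>
      define emb where "emb = (\<lambda>w l. if j * d \<le> l \<and> l < j * d + d then w (l - j * d) else z l :: real)"
      have emb_cont: "continuous_on S emb" for S
      proof (rule continuous_on_coordinatewise_then_product)
        show "continuous_on S (\<lambda>w. emb w l)" for l
          by (cases "j * d \<le> l \<and> l < j * d + d") (auto simp: emb_def intro: continuous_on_coordinate)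
      qed
      have zE: "z \<in> EE d" "z \<in> U" using z ZE by (auto simp: Z_def)
      have embE: "emb w \<in> EE m" for w
        using mult_add_le [OF j, of d] zE EdE unfolding m_def emb_def in_topspace_Euclidean_space by auto
      have emb0: "emb ?O = z"
      proof -
        have "z l = 0" if "j * d \<le> l" for l
        proof -
          have "d \<le> j * d" using False by (cases j) auto
          then have "d \<le> l" using that by (rule le_trans)
          then show ?thesis using zE(1) by (simp add: in_topspace_Euclidean_space)
        qed
        then show ?thesis by (auto simp: emb_def fun_eq_iff)
      qed
      have blk: "block d j (emb w) = w" if "w \<in> EE d" for w
        using that by (auto simp: block_def emb_def in_topspace_Euclidean_space fun_eq_iff)
      define N where "N = {w \<in> EE d. emb w \<in> U}"
      have "N = EE d \<inter> emb -` U" by (auto simp: N_def)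
      then have ope: "openin (Euclidean_space d) N"
        using continuous_openin_preimage [OF emb_cont, of "EE d" "EE m" U] U embE
        by (simp add: openin_Euclidean_space_iff)
      have ej: "e j w = block d (j - 1) (f (emb w))" if "w \<in> N" for w
        using blocks [of "emb w" j] that j False blk by (simp add: N_def)
      have "continuous_on N (\<lambda>w. block d (j - 1) (f (emb w)))"
        by (rule continuous_on_compose2 [OF continuous_on_block continuous_on_compose2 [OF f(1) emb_cont]])
          (auto simp: N_def)
      then have cont: "continuous_on N (e j)"
        using ej by (subst continuous_on_cong [OF refl]) auto
      have eE: "e j \<in> N \<rightarrow> EE d" using ej by auto
      have NV: "N \<subseteq> V j"
      proof
        fix w assume "w \<in> N"
        then show "w \<in> V j" using V [of "emb w" j] j False blk by (auto simp: N_def)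
      qed
      have zN: "{w \<in> N. e j w = ?O} = {?O}"
      proof -
        have "?O \<in> N" using zE emb0 by (simp add: N_def in_topspace_Euclidean_space)
        then show ?thesis using NV eV [of j] j False by fastforce
      qed
      have Vj: "V' j = V j" "Zs j = {?O}" using False by (auto simp: V'_def Zs_def)
      have zV: "{w \<in> V j. e j w = ?O} = {?O}" using eV [of j] j False by simp
      have cO: "compact {?O}" by simp
      show ?thesis
        unfolding Q_def Vj by (rule local_proper_extension [OF ope cont eE cO zN NV zV])
    qed
    have "\<exists>t. j < n \<longrightarrow> Q j (fst t) (fst (snd t)) (snd (snd t))" for j
    proof (cases "j < n")
      case True
      then obtain D g W where "Q j D g W" using ex by blast
      then show ?thesis by (intro exI [of _ "(D, g, W)"]) simp
    qed simp
    then have "\<exists>T. \<forall>j. j < n \<longrightarrow> Q j (fst (T j)) (fst (snd (T j))) (snd (snd (T j)))"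
      by (intro choice allI)
    then obtain T where T: "\<And>j. j < n \<Longrightarrow> Q j (fst (T j)) (fst (snd (T j))) (snd (snd (T j)))"
      by blast
    define Ds where "Ds = (\<lambda>j. fst (T j))"
    define Gs where "Gs = (\<lambda>j. fst (snd (T j)))"
    define Ws where "Ws = (\<lambda>j. snd (snd (T j)))"
    have Q: "Q j (Ds j) (Gs j) (Ws j)" if "j < n" for j
      using T [OF that] by (simp add: Ds_def Gs_def Ws_def)
    have Gs: "proper_partial d (Ds j) (Gs j)"
      and Ws: "openin (Euclidean_space d) (Ws j)" "Zs j \<subseteq> Ws j" "Ws j \<subseteq> Ds j"
      and Ge: "\<And>w. w \<in> Ws j \<Longrightarrow> Gs j w = e j w"
      and Gz: "\<And>w. w \<in> Ds j \<Longrightarrow> Gs j w = ?O \<Longrightarrow> w \<in> Zs j"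
      and deg: "brouwer_degree d (e j) (V' j) ?O = Brouwer_degree2 d (sphere_lift d (Ds j) (Gs j))"
      if "j < n" for j
      using Q [OF that] unfolding Q_def by blast+
    have GE: "Gs j w \<in> EE d" if "j < n" "w \<in> Ds j" for j w
      using Gs [OF that(1)] that(2) by (auto simp: proper_partial_def)
    \<comment> \<open>The homotopy evaluates \<open>f\<close> at all shrunken points, so the whole
      segment of each point has to stay in \<open>U\<close>. The zeros qualify, being fixed by the
      shrinking.\<close>
    define U' where "U' = {x \<in> EE m. \<forall>t\<in>{0..1}. shrink d t x \<in> O1}"
    have U'_sh: "shrink d t x \<in> U" if "x \<in> U'" "t \<in> {0..1}" for x t
      using that O1 by (auto simp: U'_def)
    then have U'U: "U' \<subseteq> U" by (metis shrink_simps(1) subsetI atLeastAtMost_iff order_refl zero_le_one)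
    have ZU': "Z \<subseteq> U'"
      using ZE UE O1 by (auto simp: U'_def Z_def)
    have "open {x. \<forall>t\<in>{0..1}. shrink d t x \<in> O1}"
    proof (subst open_subopen, intro ballI)
      fix x assume x: "x \<in> {x. \<forall>t\<in>{0..1}. shrink d t x \<in> O1}"
      have "continuous_on UNIV (\<lambda>p. shrink d (snd p) (fst p))"
        using continuous_on_compose2 [OF continuous_on_shrink [of UNIV d] continuous_on_swap] by auto
      then have op: "open ((\<lambda>p. shrink d (snd p) (fst p)) -` O1)"
        using O1(1) by (rule open_vimage [rotated])
      have tube: "{x} \<times> {0..1} \<subseteq> (\<lambda>p. shrink d (snd p) (fst p)) -` O1"
        using x by auto
      \<comment> \<open>Compactness of the parameter interval gives one neighbourhood of
        \<open>x\<close> that works for all \<open>t\<close>.\<close>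
      obtain X0 where "x \<in> X0" "open X0" "X0 \<times> {0..1} \<subseteq> (\<lambda>p. shrink d (snd p) (fst p)) -` O1"
        using Elementary_Topology.tube_lemma [OF compact_Icc op tube] by blast
      then show "\<exists>T. open T \<and> x \<in> T \<and> T \<subseteq> {x. \<forall>t\<in>{0..1}. shrink d t x \<in> O1}"
        by (intro exI [of _ X0]) auto
    qed
    then have U': "openin (Euclidean_space m) U'"
      unfolding openin_Euclidean_space_iff openin_open U'_def by auto
    \<comment> \<open>Only the last block sees the shrunken argument. The others keep
      \<open>f x\<close>, so for every \<open>t\<close> they force a zero onto the first axis, where
      shrinking has no effect.\<close>
    define h where "h = (\<lambda>t x l. if l < (n - 1) * d then f x l else f (shrink d t x) l)"
    have h_axis: "h t x = f x" if "x \<in> EE d" for t x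
      using that by (simp add: h_def fun_eq_iff)
    have h1: "h 1 x = f x" for x
      by (simp add: h_def fun_eq_iff)
    have hE: "h t x \<in> EE m" if "t \<in> {0..1}" "x \<in> U'" for t x
    proof -
      have "f x \<in> EE m" "f (shrink d t x) \<in> EE m"
        using f(2) U'U U'_sh [OF that(2,1)] that by auto
      then show ?thesis by (auto simp: h_def in_topspace_Euclidean_space)
    qed
    have hZ: "{x \<in> U'. h t x = ?O} = Z" if t: "t \<in> {0..1}" for t
    proof (intro subset_antisym subsetI)
      fix x assume x: "x \<in> {x \<in> U'. h t x = ?O}"
      have xU: "x \<in> U" "x \<in> EE m" using x U'U UE by auto
      have "x \<in> EE d"
      proof (rule in_first_block [OF _ n])
        show "x \<in> EE (n * d)" using xU by (simp add: m_def)
        fix i assume i: "1 \<le> i" "i < n"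
        have "block d (i - 1) (f x) = block d (i - 1) (h t x)"
        proof -
          have "(i - 1) * d + l < (n - 1) * d" if "l < d" for l
            using mult_add_le [of "i - 1" "n - 1" d] i that by linarith
          then show ?thesis by (auto simp: block_def h_def fun_eq_iff)
        qed
        then show "block d i x = ?O"
          using eq0 [OF xU(1) i] x by (simp add: block_zero)
      qed
      then show "x \<in> Z" using x h_axis xU by (simp add: Z_def)
    next
      fix x assume x: "x \<in> Z"
      then show "x \<in> {x \<in> U'. h t x = ?O}"
        using ZU' h_axis [OF ZE [OF x]] by (auto simp: Z_def)
    qed
    have hcont: "continuous_on ({0..1} \<times> U') (\<lambda>(t, x). h t x)"
      unfolding case_prod_unfold
    proof (rule continuous_on_coordinatewise_then_product)
      fix l
      have "continuous_on ({0..1::real} \<times> U') (\<lambda>p. f (snd p))"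
        by (rule continuous_on_compose2 [OF f(1)]) (use U'U in \<open>auto intro: continuous_on_snd continuous_on_id\<close>)
      moreover have "continuous_on ({0..1} \<times> U') (\<lambda>p. f (shrink d (fst p) (snd p)))"
        by (rule continuous_on_compose2 [OF f(1) continuous_on_shrink]) (use U'_sh in auto)
      ultimately show "continuous_on ({0..1} \<times> U') (\<lambda>p. h (fst p) (snd p) l)"
        by (cases "l < (n - 1) * d") (auto simp: h_def intro: continuous_on_product_then_coordinatewise)
    qed
    have cZ: "compact Z" using compact by (simp add: Z_def)
    obtain D g W where g: "\<forall>t\<in>{0..1}. proper_partial m D (g t)"
      and W: "openin (Euclidean_space m) W" "Z \<subseteq> W" "W \<subseteq> D" "D \<subseteq> U'"
      and gh: "\<forall>t. \<forall>x\<in>W. g t x = h t x"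
      and gz: "\<forall>t\<in>{0..1}. \<forall>x\<in>D. g t x = ?O \<longrightarrow> x \<in> Z"
      and gdeg: "Brouwer_degree2 m (sphere_lift m D (g 0)) = Brouwer_degree2 m (sphere_lift m D (g 1))"
      by (rule proper_partial_homotopy [OF U' hcont hE cZ hZ])
    \<comment> \<open>Both ends of the homotopy are evaluated by this: \<open>t = 1\<close> for
      \<open>f\<close> on \<open>U\<close>, and \<open>t = 0\<close> for \<open>h 0\<close> on
      \<open>U'\<close>.\<close>
    have lift_deg: "brouwer_degree m k Y ?O = Brouwer_degree2 m (sphere_lift m D (g t))"
      if t: "t \<in> {0..1}" and Y: "U' \<subseteq> Y" "{x \<in> Y. k x = ?O} = Z" and k: "\<And>x. x \<in> W \<Longrightarrow> k x = h t x" for k Y t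
    proof (rule brouwer_degree_sphere_lift [where W = W])
      have gt: "proper_partial m D (g t)" using g t by blast
      then show "continuous_map (nsphere m) (nsphere m) (sphere_lift m D (g t))"
        by (rule continuous_map_sphere_lift)
      show "D \<subseteq> EE m" "g t \<in> D \<rightarrow> EE m"
        using gt openin_subset unfolding proper_partial_def by blast+
      show "x \<in> Y \<and> k x = ?O" if "x \<in> D" "g t x = ?O" for x
        using gz t that Y by blast
    qed (use W Y gh k cZ in auto)
    have "brouwer_degree m f U ?O = Brouwer_degree2 m (sphere_lift m D (g 1))"
      by (rule lift_deg) (use U'U h1 in \<open>auto simp: Z_def\<close>)
    also have "\<dots> = brouwer_degree m (h 0) U' ?O"
      unfolding gdeg [symmetric] by (rule lift_deg [symmetric]) (use hZ [of 0] in auto)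
    finally have deg_f: "brouwer_degree m f U ?O = brouwer_degree m (h 0) U' ?O" .
    define D' where "D' = {x \<in> EE m. \<forall>i<n. block d i x \<in> Ds i}"
    \<comment> \<open>Precomposition with \<open>r\<close> makes output block \<open>i\<close> equal
      to block \<open>i + 1\<close> of the product map, and the last output block equal to block 0.
      This is the order in which the components of \<open>f\<close> read their variables.\<close>
    define r where "r = cyclic_shift m ^^ d"
    let ?P = "on_blocks d n Gs"
    let ?C = "sphere_lift m D' (\<lambda>x. ?P x \<circ> r)"
    have r: "r permutes {..<m}" "Brouwer_degree2 m (\<lambda>y. y \<circ> r) = (- 1) ^ ((m - 1) * d)"
      "\<And>l. l < m \<Longrightarrow> r l = (l + d) mod m"
      using rotation_degree [where m = m and k = d] unfolding r_def by blast+
    have P: "continuous_map (nsphere m) (nsphere m) (sphere_lift m D' ?P)"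
      "Brouwer_degree2 m (sphere_lift m D' ?P) = (\<Prod>i<n. Brouwer_degree2 d (sphere_lift d (Ds i) (Gs i)))"
      using on_blocks_degree [OF Gs order_refl] unfolding D'_def m_def by auto
    have R: "continuous_map (nsphere m) (nsphere m) (\<lambda>y. y \<circ> r)"
      by (rule continuous_map_nsphere_permute [OF permutes_lessThan_atMost [OF r(1)]])
    have C_eq: "?C y = ((\<lambda>y. y \<circ> r) \<circ> sphere_lift m D' ?P) y" for y
      by (simp add: sphere_lift_def north_pole_permute [OF r(1)] inv_stereo_permute [OF r(1)])
    then have C_eq': "?C = (\<lambda>y. y \<circ> r) \<circ> sphere_lift m D' ?P"
      by (rule ext)
    have C: "continuous_map (nsphere m) (nsphere m) ?C"
      unfolding C_eq' by (rule continuous_map_compose [OF P(1) R])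
    have degC: "Brouwer_degree2 m ?C
        = (- 1) ^ ((m - 1) * d) * (\<Prod>i<n. Brouwer_degree2 d (sphere_lift d (Ds i) (Gs i)))"
      unfolding C_eq' Brouwer_degree2_compose [OF P(1) R] P(2) r(2) by (rule refl)
    have PE: "?P x \<circ> r \<in> EE m" if "x \<in> EE m" for x
      using on_blocks_in_Euclidean_space [of n n x d Gs] that permute_in_Euclidean_space [OF r(1)]
      by (simp add: m_def)
    \<comment> \<open>Here every \<open>Gs i\<close> may be replaced by \<open>e i\<close>, and the
      shrunken point at \<open>t = 0\<close> lies in \<open>U\<close>.\<close>
    define W' where "W' = U' \<inter> ((\<Inter>i\<in>{..<n}. {x \<in> EE m. block d i x \<in> Ws i}) \<inter> EE m)"
    have blkZ: "block d i x \<in> Zs i" if "x \<in> Z" "i < n" for x i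
    proof (cases "i = 0")
      case True
      then show ?thesis using that ZE by (simp add: Zs_def block_0)
    next
      case False
      then show ?thesis
        using eq0 [of x i] that by (auto simp: Zs_def Z_def block_zero)
    qed
    have "brouwer_degree m (h 0) U' ?O = Brouwer_degree2 m ?C"
    proof (rule brouwer_degree_sphere_lift [OF C, where W = W'])
      show "D' \<subseteq> EE m" by (auto simp: D'_def)
      then show "(\<lambda>x. ?P x \<circ> r) \<in> D' \<rightarrow> EE m" using PE by auto
      show "openin (Euclidean_space m) W'"
        unfolding W'_def
        by (intro openin_Int U' openin_INT openin_block_preimage Ws) auto
      show "W' \<subseteq> D'" using Ws(3) by (auto simp: W'_def D'_def subset_iff)
      show "W' \<subseteq> U'" by (simp add: W'_def)
      show "{x \<in> U'. h 0 x = ?O} \<subseteq> W'"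
        using hZ [of 0] ZU' UE U'U blkZ Ws(2) by (auto simp: W'_def subset_iff)
      show "compact {x \<in> U'. h 0 x = ?O}" using hZ [of 0] cZ by simp
      show "?P x \<circ> r = h 0 x" if x: "x \<in> W'" for x
      proof
        fix l
        have xU: "x \<in> U'" "x \<in> EE m" "x \<in> U" "\<And>i. i < n \<Longrightarrow> block d i x \<in> Ws i"
          using x U'U by (auto simp: W'_def)
        consider "l \<ge> m" | "l < m" "l < (n - 1) * d" | "l < m" "(n - 1) * d \<le> l" by linarith
        then show "(?P x \<circ> r) l = h 0 x l"
        proof cases
          case 1
          then show ?thesis
            using PE [OF xU(2)] hE [of 0 x] xU(1) by (simp add: in_topspace_Euclidean_space)
        next
          case 2
          then have "0 < d" by (cases d) auto
          have i: "Suc (l div d) < n"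
            using less_mult_imp_div_less [OF 2(2)] by simp
          have "l + d < m"
            using 2(2) n by (cases n) (auto simp: m_def)
          then have "(?P x \<circ> r) l = ?P x (l + d)" using r(3) [OF 2(1)] by simp
          also have "\<dots> = Gs (Suc (l div d)) (block d (Suc (l div d)) x) (l mod d)"
            using \<open>l + d < m\<close> \<open>0 < d\<close> by (simp add: on_blocks_def m_def)
          also have "\<dots> = e (Suc (l div d)) (block d (Suc (l div d)) x) (l mod d)"
            using Ge [OF i] xU(4) [OF i] by simp
          also have "\<dots> = block d (l div d) (f x) (l mod d)"
            using blocks [OF xU(3), of "Suc (l div d)"] i by simp
          also have "\<dots> = h 0 x l"
            using block_div_mod [OF 2(2)] 2(2) by (simp add: h_def)
          finally show ?thesis .
        next
          case 3
          define j where "j = l - (n - 1) * d"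
          have m_eq: "m = (n - 1) * d + d"
            using n by (cases n) (auto simp: m_def)
          have j: "l = (n - 1) * d + j" "j < d"
            using 3 m_eq by (auto simp: j_def)
          have lj: "l + d = j + m" "j < m"
            using j m_eq dm by linarith+
          then have "(l + d) mod m = j" by simp
          then have "(?P x \<circ> r) l = ?P x j" using r(3) [OF 3(1)] by simp
          also have "\<dots> = Gs 0 (block d 0 x) j"
            using j(2) lj(2) by (simp add: on_blocks_def m_def)
          also have "\<dots> = e 0 (block d 0 x) j"
            using Ge [of 0] xU(4) [of 0] n by simp
          \<comment> \<open>The index has wrapped around to block 0. The point
            \<open>block d 0 x\<close> is \<open>shrink d 0 x\<close>, an end of the segment that
            \<open>U'\<close> keeps inside \<open>U\<close>.\<close>
          also have "\<dots> = block d (n - 1) (f (block d 0 x)) j"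
            using last [of "block d 0 x"] U'_sh [OF xU(1), of 0] by (simp add: block_0)
          also have "\<dots> = h 0 x l"
            using j by (simp add: block_def [of d "n - Suc 0"] h_def block_0)
          finally show ?thesis .
        qed
      qed
      fix x assume x: "x \<in> D'" "?P x \<circ> r = ?O"
      have xE: "x \<in> EE m" "\<And>i. i < n \<Longrightarrow> block d i x \<in> Ds i" using x by (auto simp: D'_def)
      have P0: "?P x = ?O"
      proof
        fix l
        have "?P x l = (?P x \<circ> r) (inv_into UNIV r l)" using permutes_inverses(1) [OF r(1)] by simp
        then show "?P x l = 0" by (simp add: x(2))
      qed
      \<comment> \<open>The rotation only permutes coordinates, so each block of the product
        vanishes separately. The blocks after the first are then 0, and \<open>x\<close> coincides
        with its block 0, a point of \<open>Z\<close>.\<close>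
      have Gx: "block d i x \<in> Zs i" if i: "i < n" for i
      proof (rule Gz [OF i xE(2) [OF i]])
        have "Gs i (block d i x) = block d i (?P x)"
          using block_on_blocks [where g = Gs, OF GE [OF i xE(2) [OF i]] i] by simp
        then show "Gs i (block d i x) = ?O" by (simp add: P0 block_zero)
      qed
      have "x \<in> EE d"
      proof (rule in_first_block [OF _ n])
        show "x \<in> EE (n * d)" using xE by (simp add: m_def)
        show "block d i x = ?O" if "1 \<le> i" "i < n" for i
          using Gx [OF that(2)] that by (simp add: Zs_def)
      qed
      then have "x \<in> Z" using Gx [of 0] n by (simp add: Zs_def block_0)
      then show "x \<in> U' \<and> h 0 x = ?O" using hZ [of 0] by auto
    qed
    then have "brouwer_degree m f U ?O =
        (- 1) ^ ((m - 1) * d) * (\<Prod>i<n. brouwer_degree d (e i) (V' i) ?O)"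
      using deg_f degC deg by simp
    also have "(\<Prod>i<n. brouwer_degree d (e i) (V' i) ?O)
        = brouwer_degree d (e 0) (EE d \<inter> U) ?O * (\<Prod>j=1..<n. brouwer_degree d (e j) (V j) ?O)"
    proof -
      have "{..<n} = insert 0 {1..<n}" using n by auto
      then show ?thesis by (simp add: V'_def)
    qed
    also have "(- 1) ^ ((m - 1) * d) = (- 1 :: int) ^ (d * (n + 1))"
      unfolding m_def by (rule minus_one_power_rotation [OF n])
    finally show ?thesis by (simp add: mult.assoc)
  qed
qed

section \<open>Charts\<close>

lemma chart_bij:
  assumes "is_basis d b V"
  shows "bij_betw (chart d b) (EE d) V"
proof (rule bij_betw_imageI)
  have b: "inj_on b {..<d}" "independent (b ` {..<d})" "span (b ` {..<d}) = V"
    using assms by (auto simp: is_basis_def)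
  show "inj_on (chart d b) (EE d)"
  proof (rule inj_onI)
    fix x y assume xy: "x \<in> EE d" "y \<in> EE d" "chart d b x = chart d b y"
    \<comment> \<open>Coefficients are moved from indices to basis vectors, the form in which
      independence is stated.\<close>
    define u where "u = (\<lambda>v. x (inv_into {..<d} b v) - y (inv_into {..<d} b v))"
    have u: "u (b j) = x j - y j" if "j < d" for j
      using that b(1) by (simp add: u_def)
    have "(\<Sum>v\<in>b ` {..<d}. u v *\<^sub>R v) = (\<Sum>j<d. u (b j) *\<^sub>R b j)"
      using b(1) by (simp add: sum.reindex)
    also have "\<dots> = (\<Sum>j<d. x j *\<^sub>R b j) - (\<Sum>j<d. y j *\<^sub>R b j)"
      by (simp add: u scaleR_left_diff_distrib sum_subtractf)
    also have "\<dots> = 0"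
      using xy(3) by (simp add: chart_def)
    finally have "u (b j) = 0" if "j < d" for j
      using independentD [OF b(2), of "b ` {..<d}" u "b j"] that by auto
    then show "x = y"
      using u xy(1,2) by (auto simp: fun_eq_iff in_topspace_Euclidean_space) (metis eq_iff_diff_eq_0 not_less)
  qed
  show "chart d b ` EE d = V"
  proof (intro subset_antisym subsetI)
    fix v assume "v \<in> chart d b ` EE d"
    then show "v \<in> V"
      unfolding b(3) [symmetric] chart_def by (auto intro!: span_sum span_scale intro: span_base)
  next
    fix v assume "v \<in> V"
    then obtain u where "v = (\<Sum>w\<in>b ` {..<d}. u w *\<^sub>R w)"
      unfolding b(3) [symmetric] span_finite [OF finite_imageI [OF finite_lessThan]] by auto
    then have "v = chart d b (\<lambda>j. if j < d then u (b j) else 0)"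
      using b(1) by (simp add: sum.reindex chart_def)
    then show "v \<in> chart d b ` EE d"
      by (auto simp: in_topspace_Euclidean_space)
  qed
qed

lemma chart_zero [simp]: "chart d b (\<lambda>i. 0) = 0"
  by (simp add: chart_def)

lemma zero_in_Euclidean_space [simp]: "(\<lambda>i. 0) \<in> EE d"
  by (simp add: in_topspace_Euclidean_space)

lemma product_chart_block:
  "product_chart n d b x = (\<lambda>i\<in>{1..n}. chart d (b i) (block d (i - 1) x))"
  by (simp add: product_chart_def chart_def block_def)

lemma product_chart_bij:
  fixes b :: "nat \<Rightarrow> nat \<Rightarrow> 'a::real_vector"
  assumes b: "\<And>i. i \<in> {1..n} \<Longrightarrow> is_basis d (b i) (V i)"
  shows "bij_betw (product_chart n d b) (EE (n * d)) (\<Pi>\<^sub>E i\<in>{1..n}. V i)"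
proof (rule bij_betw_imageI)
  have bij: "bij_betw (chart d (b i)) (EE d) (V i)" if "i \<in> {1..n}" for i
    by (rule chart_bij [OF b [OF that]])
  show "inj_on (product_chart n d b) (EE (n * d))"
  proof (rule inj_onI)
    fix x y assume xy: "x \<in> EE (n * d)" "y \<in> EE (n * d)" "product_chart n d b x = product_chart n d b y"
    show "x = y"
    proof (rule eq_if_blocks_eq [OF xy(1,2)])
      fix i assume "i < n"
      then have i: "Suc i \<in> {1..n}" by simp
      have "chart d (b (Suc i)) (block d i x) = chart d (b (Suc i)) (block d i y)"
        using fun_cong [OF xy(3), of "Suc i"] i by (simp add: product_chart_block)
      then show "block d i x = block d i y"
        using bij_betw_imp_inj_on [OF bij [OF i]] by (auto dest: inj_onD)
    qed
  qed
  show "product_chart n d b ` EE (n * d) = (\<Pi>\<^sub>E i\<in>{1..n}. V i)"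
  proof (intro subset_antisym subsetI)
    fix v assume "v \<in> product_chart n d b ` EE (n * d)"
    then show "v \<in> (\<Pi>\<^sub>E i\<in>{1..n}. V i)"
      using bij_betwE [OF bij] by (auto simp: product_chart_block)
  next
    fix v assume v: "v \<in> (\<Pi>\<^sub>E i\<in>{1..n}. V i)"
    define w where "w = (\<lambda>i. inv_into (EE d) (chart d (b i)) (v i))"
    have w: "chart d (b i) (w i) = v i" "w i \<in> EE d" if "i \<in> {1..n}" for i
      unfolding w_def using bij_betw_inv_into_right [OF bij [OF that]]
        bij_betwE [OF bij_betw_inv_into [OF bij [OF that]]] PiE_mem [OF v that] by auto
    \<comment> \<open>The quotient and remainder of \<open>l\<close> by \<open>d\<close> are the
      block and the position in it; \<open>Suc\<close> passes to factors counted from 1.\<close>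
    define x where "x = (\<lambda>l. if l < n * d then w (Suc (l div d)) (l mod d) else 0)"
    have "block d i x = w (Suc i)" if "i < n" for i
    proof
      fix j
      show "block d i x j = w (Suc i) j"
      proof (cases "j < d")
        case True
        then have "i * d + j < n * d"
          using mult_add_le [OF that, of d] by linarith
        then show ?thesis
          using True by (simp add: block_def x_def)
      next
        case False
        then show ?thesis
          using w(2) [of "Suc i"] that by (simp add: block_def in_topspace_Euclidean_space)
      qed
    qed
    then have "chart d (b i) (block d (i - 1) x) = v i" if "i \<in> {1..n}" for i
      using w(1) [OF that] that by (cases i) auto
    then have "v = product_chart n d b x"
      using v by (auto simp: product_chart_block PiE_iff extensional_def fun_eq_iff)
    moreover have "x \<in> EE (n * d)" by (simp add: x_def in_topspace_Euclidean_space)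
    ultimately show "v \<in> product_chart n d b ` EE (n * d)" by blast
  qed
qed

theorem lemma2p4:
  fixes n d :: nat
    and X :: "nat \<Rightarrow> 'x::real_normed_vector set"
    and Z :: "nat \<Rightarrow> 'z::real_normed_vector set"
    and domL :: "nat \<Rightarrow> 'x set"
    and L :: "nat \<Rightarrow> 'x \<Rightarrow> 'z"
    and P :: "nat \<Rightarrow> 'x \<Rightarrow> 'x"
    and Q :: "nat \<Rightarrow> 'z \<Rightarrow> 'z"
    and K :: "nat \<Rightarrow> 'z \<Rightarrow> 'x"
    and J :: "nat \<Rightarrow> 'z \<Rightarrow> 'x"
    and domM :: "(nat \<Rightarrow> 'x) set"
    and M :: "nat \<Rightarrow> 'x \<Rightarrow> 'z"
    and Mn :: "(nat \<Rightarrow> 'x) \<Rightarrow> 'z"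
    and \<Omega> :: "(nat \<Rightarrow> 'x) set"
    and b :: "nat \<Rightarrow> nat \<Rightarrow> 'x"
    and c :: "nat \<Rightarrow> nat \<Rightarrow> 'z"
  defines "kerL \<equiv> \<lambda>i. ker_on (domL i) (L i)"
  defines "\<Omega>ker \<equiv> \<lambda>i. (\<lambda>u. u i) ` \<Omega> \<inter> kerL i"
  defines "\<Omega>kerL \<equiv> \<Omega> \<inter> (\<Pi>\<^sub>E i\<in>{1..n}. kerL i)"
  defines "\<Omega>1 \<equiv> {w \<in> kerL 1. first_axis n w \<in> \<Omega>}"
  assumes setting: "cyclic_coincidence n X Z domL L P Q K J domM M Mn \<Omega>"
    and h1: "\<And>i. i \<in> {1..n} \<Longrightarrow> dim (kerL i) = d"
    and ker_coords: "\<And>i. i \<in> {1..n} \<Longrightarrow> is_basis d (b i) (kerL i)"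
    and coker_coords: "\<And>i. i \<in> {1..n} \<Longrightarrow> is_basis d (c i) (Q i ` Z i)"
    and J_id: "\<And>i x. i \<in> {1..n} \<Longrightarrow> x \<in> topspace (Euclidean_space d) \<Longrightarrow>
                 J i (chart d (c i) x) = chart d (b i) x"
    and deg_defined:
      "degB_defined (n * d) (product_chart n d b) (product_chart n d b)
         (finite_map n J Q M Mn) \<Omega>kerL (\<lambda>i\<in>{1..n}. 0)"
    and h2: "\<And>i. i \<in> {2..n} \<Longrightarrow> 0 \<in> \<Omega>ker i"
    and h3: "\<And>i. i \<in> {1..<n} \<Longrightarrow> {w \<in> \<Omega>ker (i + 1). eta J Q M i w = 0} = {0}"
  shows "degB (n * d) (product_chart n d b) (product_chart n d b)
           (finite_map n J Q M Mn) \<Omega>kerL (\<lambda>i\<in>{1..n}. 0)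
         = (- 1) ^ (d * (n + 1))
           * degB d (chart d (b 1)) (chart d (b n)) (eta_last n J Q Mn) \<Omega>1 0
           * (\<Prod>i=1..<n. degB d (chart d (b (i + 1))) (chart d (b i)) (eta J Q M i) (\<Omega>ker (i + 1)) 0)"
proof -
  interpret cyclic_coincidence n X Z domL L P Q K J domM M Mn \<Omega> by (rule setting)
  let ?O = "\<lambda>i::nat. 0::real"
  let ?pc = "product_chart n d b"
  let ?F = "finite_map n J Q M Mn"
  define co where "co = (\<lambda>i. inv_into (EE d) (chart d (b i)))"
  have bij: "bij_betw (chart d (b i)) (EE d) (kerL i)" if "i \<in> {1..n}" for i
    by (rule chart_bij [OF ker_coords [OF that]])
  have co_chart: "co i (chart d (b i) x) = x" if "i \<in> {1..n}" "x \<in> EE d" for i x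
    unfolding co_def using bij [OF that(1)] that(2) by (simp add: bij_betw_def)
  have chart_co: "chart d (b i) (co i v) = v" "co i v \<in> EE d" if "i \<in> {1..n}" "v \<in> kerL i" for i v
    unfolding co_def using bij_betw_inv_into_right [OF bij [OF that(1)] that(2)]
      bij_betwE [OF bij_betw_inv_into [OF bij [OF that(1)]]] that(2) by auto
  have co0: "co i 0 = ?O" if "i \<in> {1..n}" for i
    using co_chart [OF that, of ?O] by simp
  have chart_in: "chart d (b i) x \<in> kerL i" if "i \<in> {1..n}" "x \<in> EE d" for i x
    using bij_betwE [OF bij [OF that(1)]] that(2) by blast
  have pc: "bij_betw ?pc (EE (n * d)) (\<Pi>\<^sub>E i\<in>{1..n}. kerL i)"
    by (rule product_chart_bij [OF ker_coords])
  define pco where "pco = inv_into (EE (n * d)) ?pc"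
  have pc_pco: "?pc (pco v) = v" "pco v \<in> EE (n * d)" if "v \<in> (\<Pi>\<^sub>E i\<in>{1..n}. kerL i)" for v
    unfolding pco_def using bij_betw_inv_into_right [OF pc that]
      bij_betwE [OF bij_betw_inv_into [OF pc]] that by auto
  have pc0: "?pc ?O = (\<lambda>i\<in>{1..n}. 0)"
    by (simp add: product_chart_block block_zero)
  have pco0: "pco (\<lambda>i\<in>{1..n}. 0) = ?O"
    using pc unfolding pco_def bij_betw_def pc0 [symmetric] by (intro inv_into_f_f) auto
  have block_pco: "block d (i - 1) (pco v) = co i (v i)"
    if "v \<in> (\<Pi>\<^sub>E i\<in>{1..n}. kerL i)" "i \<in> {1..n}" for v i
  proof -
    have "v i = chart d (b i) (block d (i - 1) (pco v))"
      using fun_cong [OF pc_pco(1) [OF that(1)], of i] that(2) by (simp add: product_chart_block)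
    then show ?thesis using co_chart [OF that(2)] by simp
  qed
  have JQ: "- J i (Q i z) \<in> kerL i" if "i \<in> {1..n}" "z \<in> Z i" for i z
    using J_linear [OF that(1)] that(2) subspace_neg unfolding linear_map_on_def kerL_def by blast
  have comp_Z: "cyclic_operator n M Mn u i \<in> Z i" if "u \<in> \<Omega>" "i \<in> {1..n}" for u i
    using M_range Omega_sub that by (auto simp: PiE_iff image_subset_iff subset_iff)
  have eta_in: "eta J Q M i (u (i + 1)) \<in> kerL i" if "u \<in> \<Omega>" "i \<in> {1..<n}" for u i
    using JQ [of i "M i (u (i + 1))"] comp_Z [OF that(1), of i] that(2)
    by (simp add: eta_def cyclic_operator_def)
  have last_in: "- J n (Q n (Mn u)) \<in> kerL n" if "u \<in> \<Omega>" for u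
    using JQ [of n "Mn u"] comp_Z [OF that, of n] n_pos by (simp add: cyclic_operator_def)
  have F_in: "?F u \<in> (\<Pi>\<^sub>E i\<in>{1..n}. kerL i)" if "u \<in> \<Omega>" for u
    using eta_in [OF that] last_in [OF that] by (auto simp: finite_map_def PiE_iff dest: le_neq_implies_less)
  define f where "f = pull_map (n * d) ?pc ?pc ?F"
  define U where "U = pull_set (n * d) ?pc \<Omega>kerL"
  \<comment> \<open>The index is the input block: \<open>e j\<close> represents
    \<open>\<eta>\<^sub>j\<close>, which reads variable \<open>j + 1\<close> and thus block
    \<open>j\<close>. The value at 0 represents \<open>\<eta>\<^sub>n\<close>, which reads the first
    variable.\<close>
  define e where "e = (\<lambda>j. if j = 0 then pull_map d (chart d (b 1)) (chart d (b n)) (eta_last n J Q Mn)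
    else pull_map d (chart d (b (j + 1))) (chart d (b j)) (eta J Q M j))"
  define V where "V = (\<lambda>j. pull_set d (chart d (b (j + 1))) (\<Omega>ker (j + 1)))"
  have f_eq: "f x = pco (?F (?pc x))" for x
    by (simp add: f_def pull_map_def pco_def)
  have U_iff: "x \<in> U \<longleftrightarrow> x \<in> EE (n * d) \<and> ?pc x \<in> \<Omega>" for x
    using bij_betwE [OF pc] by (auto simp: U_def pull_set_def \<Omega>kerL_def)
  have e_eq: "e j w = co j (eta J Q M j (chart d (b (j + 1)) w))" if "1 \<le> j" for j w
    using that by (simp add: e_def pull_map_def co_def)
  have e0_eq: "e 0 w = co n (eta_last n J Q Mn (chart d (b 1) w))" for w
    by (simp add: e_def pull_map_def co_def)
  have V_iff: "w \<in> V j \<longleftrightarrow> w \<in> EE d \<and> chart d (b (j + 1)) w \<in> \<Omega>ker (j + 1)" for w j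
    by (simp add: V_def pull_set_def)
  \<comment> \<open>A vector of \<open>EE d\<close>, read in \<open>EE (n * d)\<close>, has all
    blocks after the first equal to 0.\<close>
  have axis: "?pc w = first_axis n (chart d (b 1) w)" if "w \<in> EE d" for w
  proof
    fix i
    have "block d (i - 1) w = (if i = 1 then w else ?O)" if i: "i \<in> {1..n}"
    proof (cases "i = 1")
      case False
      then obtain k where "i = Suc (Suc k)" using i by (cases i; cases "i - 1") auto
      then show ?thesis
        using \<open>w \<in> EE d\<close> by (auto simp: block_def in_topspace_Euclidean_space fun_eq_iff)
    qed (use \<open>w \<in> EE d\<close> in \<open>simp add: block_0\<close>)
    then show "?pc w i = first_axis n (chart d (b 1) w) i"
      by (simp add: product_chart_block first_axis_def)
  qed
  \<comment> \<open>This supplies openness of \<open>U\<close>, continuity of \<open>f\<close> and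
    compactness of its zero set.\<close>
  have def: "brouwer_degree_defined (n * d) f U ?O"
    using deg_defined unfolding degB_defined_def f_def U_def pco_def [symmetric] pco0 .
  have "brouwer_degree (n * d) f U ?O = (- 1) ^ (d * (n + 1)) * brouwer_degree d (e 0) (EE d \<inter> U) ?O
      * (\<Prod>j=1..<n. brouwer_degree d (e j) (V j) ?O)"
  proof (rule cyclic_product_degree [OF n_pos])
    show U: "openin (Euclidean_space (n * d)) U"
      using def by (simp add: brouwer_degree_defined_def)
    have "topspace (subtopology (Euclidean_space (n * d)) U) = U"
      using openin_subset [OF U] by auto
    then show "continuous_on U f" "f \<in> U \<rightarrow> EE (n * d)"
      using def by (auto simp: brouwer_degree_defined_def cm_Euclidean_space_iff_continuous_on)
    show "compact {x \<in> U. f x = ?O}"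
      using def by (simp add: brouwer_degree_defined_def Euclidean_space_def compactin_subtopology
          euclidean_product_topology)
    fix x j assume x: "x \<in> U" and j: "1 \<le> j" "j < n"
    have u: "?pc x \<in> \<Omega>" "?pc x (j + 1) = chart d (b (j + 1)) (block d j x)"
      using x j by (auto simp: U_iff product_chart_block)
    show "block d (j - 1) (f x) = e j (block d j x)"
      using block_pco [OF F_in [OF u(1)], of j] j u(2) by (simp add: f_eq e_eq finite_map_def)
    show "block d j x \<in> V j"
      using u chart_in [of "j + 1" "block d j x"] j unfolding V_iff \<Omega>ker_def
      by (auto intro: image_eqI [of _ _ "?pc x"])
  next
    fix j assume j: "1 \<le> j" "j < n"
    \<comment> \<open>The inverse chart can be trusted only on \<open>kerL j\<close>. Tracing
      \<open>chart d (b (j + 1)) w\<close> back to a component of a point of \<open>\<Omega>\<close>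
      shows that \<open>eta\<close> takes its value there.\<close>
    have "e j w = ?O \<longleftrightarrow> eta J Q M j (chart d (b (j + 1)) w) = 0" if w: "w \<in> V j" for w
    proof -
      obtain u where "u \<in> \<Omega>" "chart d (b (j + 1)) w = u (j + 1)"
        using w by (auto simp: V_iff \<Omega>ker_def)
      then have "eta J Q M j (chart d (b (j + 1)) w) \<in> kerL j"
        using eta_in [of u j] j by simp
      then show ?thesis
        using chart_co [of j] co0 [of j] j chart_zero by (metis atLeastAtMost_iff e_eq less_imp_le)
    qed
    then have "{w \<in> V j. e j w = ?O}
        = {w \<in> EE d. chart d (b (j + 1)) w \<in> {v \<in> \<Omega>ker (j + 1). eta J Q M j v = 0}}"
      by (auto simp: V_iff)
    also have "\<dots> = {w \<in> EE d. chart d (b (j + 1)) w = 0}"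
      using h3 [of j] j by simp
    also have "\<dots> = {?O}"
    proof -
      have "w = ?O" if "w \<in> EE d" "chart d (b (j + 1)) w = 0" for w
        using co_chart [of "j + 1" w] co0 [of "j + 1"] that j by simp
      then show ?thesis by auto
    qed
    finally show "{w \<in> V j. e j w = ?O} = {?O}" .
  next
    fix w assume w: "w \<in> EE d" "w \<in> U"
    then have u: "?pc w \<in> \<Omega>" by (simp add: U_iff)
    show "e 0 w = block d (n - 1) (f w)"
      using block_pco [OF F_in [OF u], of n] n_pos axis [OF w(1)]
      by (simp add: f_eq e0_eq finite_map_def eta_last_def)
  qed
  moreover have "brouwer_degree (n * d) f U ?O = degB (n * d) ?pc ?pc ?F \<Omega>kerL (\<lambda>i\<in>{1..n}. 0)"
    unfolding degB_def f_def U_def pco_def [symmetric] pco0 by (rule refl)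
  moreover have "brouwer_degree d (e 0) (EE d \<inter> U) ?O
      = degB d (chart d (b 1)) (chart d (b n)) (eta_last n J Q Mn) \<Omega>1 0"
  proof -
    have "x \<in> EE (n * d)" if "x \<in> EE d" for x
      using that mult_add_le [of 0 n d] n_pos unfolding in_topspace_Euclidean_space
      by (metis add_0 le_trans mult_0 less_le_trans zero_less_one)
    then have "EE d \<inter> U = pull_set d (chart d (b 1)) \<Omega>1"
      using axis chart_in [of 1] n_pos by (auto simp: U_iff pull_set_def \<Omega>1_def)
    moreover have "inv_into (EE d) (chart d (b n)) 0 = ?O"
      using co0 [of n] n_pos by (simp add: co_def)
    ultimately show ?thesis
      by (simp add: degB_def e_def)
  qed
  moreover have "brouwer_degree d (e j) (V j) ?O
      = degB d (chart d (b (j + 1))) (chart d (b j)) (eta J Q M j) (\<Omega>ker (j + 1)) 0" if "j \<in> {1..<n}" for j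
    using co0 [of j] that by (simp add: degB_def e_def V_def co_def)
  ultimately show ?thesis by simp
qed

end
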